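(* Let $N\in\mathbb N$ and write $N = 2^s p_1^{s_1}\cdots p_t^{s_t}$ where $t\ge 0$, the $p_i$ are distinct odd primes, $s_i\in\mathbb N$ (so $s_i\ge 1$), and $s\in\mathbb Z_{\ge 0}$. (a) The number of congruence lifts of the subgroup $\overline{\Gamma_0(N)}\le \mathrm{PSL}_2(\mathbb Z)$ is $$\begin{cases} 1, & \text{if } s\le 1 \text{ and } p_i\equiv 1 \pmod 4 \text{ for all } i,\\ 1+2^{s+t}, & \text{if } s\le 1 \text{ and } p_i\equiv 3\pmod 4 \text{ for at least one } i,\\ 1+2^{\min\{3,s\}+t}, & \text{if } s\ge 2.\end{cases}$$ (b) The number of congruence lifts of the subgroup $\overline{\Gamma_1(N)}\le \mathrm{PSL}_2(\mathbb Z)$ is $$\begin{cases} 1, & \text{if } N\le 2,\\ 3, & \text{if } N>2 \text{ is odd},\\ 5, & \text{if } N>2 \text{ is even}.\end{cases}$$ (c) The number of congruence lifts of the subgroup $\overline{\Gamma(N)}\le \mathrm{PSL}_2(\mathbb Z)$ is $$\begin{cases} 1, & \text{if } N=1,\\ 3, & \text{if } N>1 \text{ is odd},\\ 5, & \text{if } N=2,\\ 9, & \text{if } N>2 \text{ is even}.\end{cases}$$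
   Context: $\Gamma_0(N)$, $\Gamma_1(N)$, $\Gamma(N)$ are the standard congruence subgroups of $\mathrm{SL}_2(\mathbb Z)$: matrices that modulo $N$ are, respectively, upper triangular, upper triangular with both diagonal entries $1$, and the identity. For a subgroup $\Gamma\le \mathrm{SL}_2(\mathbb Z)$, $\overline\Gamma$ denotes its image in $\mathrm{PSL}_2(\mathbb Z)=\mathrm{SL}_2(\mathbb Z)/\{\pm 1\}$. A subgroup $\Gamma_1$ of $\mathrm{SL}_2(\mathbb Z)$ (of finite index) is a lift of $\overline\Gamma$ if the image of $\Gamma_1$ under the canonical homomorphism $\mathrm{SL}_2(\mathbb Z)\to\mathrm{PSL}_2(\mathbb Z)$ is equal to $\overline\Gamma$. A lift is a congruence lift if it is a congruence subgroup, i.e. if it contains $\Gamma(M)$ for some $M\in\mathbb N$. Lifts are counted as subgroups of $\mathrm{SL}_2(\mathbb Z)$ (not up to conjugacy). *)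

theory Defs
  imports
    "HOL-Analysis.Determinants"
    "HOL-Algebra.Coset"
    "HOL-Number_Theory.Cong"
begin

definition SL2Z :: "(int^2^2) monoid" where
  "SL2Z = \<lparr>carrier = {A. det A = 1}, mult = (**), one = mat 1\<rparr>"

definition pm_one :: "(int^2^2) set" where
  "pm_one = {mat 1, - mat 1}"

definition PSL2Z :: "(int^2^2) set monoid" where
  "PSL2Z = SL2Z Mod pm_one"

definition to_PSL2Z :: "int^2^2 \<Rightarrow> (int^2^2) set" where
  "to_PSL2Z A = pm_one #>\<^bsub>SL2Z\<^esub> A"

definition Gamma0 :: "nat \<Rightarrow> (int^2^2) set" where
  "Gamma0 N = {A \<in> carrier SL2Z. [A $ 2 $ 1 = 0] (mod int N)}"

definition Gamma1 :: "nat \<Rightarrow> (int^2^2) set" where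
  "Gamma1 N = {A \<in> carrier SL2Z. [A $ 2 $ 1 = 0] (mod int N)
      \<and> [A $ 1 $ 1 = 1] (mod int N) \<and> [A $ 2 $ 2 = 1] (mod int N)}"

definition Gamma :: "nat \<Rightarrow> (int^2^2) set" where
  "Gamma N = {A \<in> carrier SL2Z. \<forall>i j. [A $ i $ j = (mat 1 :: int^2^2) $ i $ j] (mod int N)}"

text \<open>The condition \<open>M \<ge> 1\<close> is essential, since \<open>Gamma 0\<close> is the trivial subgroup.\<close>

definition congruence_subgroup :: "(int^2^2) set \<Rightarrow> bool" where
  "congruence_subgroup H \<longleftrightarrow> subgroup H SL2Z \<and> (\<exists>M\<ge>1. Gamma M \<subseteq> H)"

text \<open>Here \<open>D\<close> is a subgroup of \<open>PSL2Z\<close>.\<close>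

definition is_lift :: "(int^2^2) set \<Rightarrow> (int^2^2) set set \<Rightarrow> bool" where
  "is_lift H D \<longleftrightarrow> subgroup H SL2Z \<and> finite (rcosets\<^bsub>SL2Z\<^esub> H) \<and> to_PSL2Z ` H = D"

definition congruence_lifts :: "(int^2^2) set set \<Rightarrow> (int^2^2) set set" where
  "congruence_lifts D = {H. is_lift H D \<and> congruence_subgroup H}"

lemma SL2Z_simps [simp]:
  "carrier SL2Z = {A. det A = 1}" "mult SL2Z = (**)" "one SL2Z = mat 1"
  by (simp_all add: SL2Z_def)

lemma matrix_neg_simps:
  fixes A B :: "int^2^2"
  shows "(- A) ** B = - (A ** B)" "A ** (- B) = - (A ** B)" "det (- A) = det A"
  by (simp_all add: matrix_matrix_mult_def vec_eq_iff sum_negf det_2)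

lemma adjugate_2:
  fixes A :: "int^2^2"
  assumes "det A = 1"
  defines "B \<equiv> vector [vector [A $ 2 $ 2, - A $ 1 $ 2], vector [- A $ 2 $ 1, A $ 1 $ 1]]"
  shows "det B = 1" "B ** A = mat 1" "A ** B = mat 1"
  using assms(1) unfolding B_def
  by (simp_all add: det_2 matrix_matrix_mult_def vec_eq_iff forall_2 sum_2 mat_def mult.commute)

lemma group_SL2Z: "group SL2Z"
proof (rule groupI)
  fix A assume "A \<in> carrier SL2Z"
  then show "\<exists>B\<in>carrier SL2Z. B \<otimes>\<^bsub>SL2Z\<^esub> A = \<one>\<^bsub>SL2Z\<^esub>"
    using adjugate_2[of A] by auto
qed (auto simp: det_mul matrix_mul_assoc)

lemma normal_pm_one: "pm_one \<lhd> SL2Z"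
proof -
  interpret group SL2Z by (rule group_SL2Z)
  have mem: "pm_one \<subseteq> carrier SL2Z"
    by (auto simp: pm_one_def matrix_neg_simps)
  have sub: "subgroup pm_one SL2Z"
  proof (rule subgroupI)
    fix A assume A: "A \<in> pm_one"
    then have "A \<otimes>\<^bsub>SL2Z\<^esub> A = \<one>\<^bsub>SL2Z\<^esub>"
      by (auto simp: pm_one_def matrix_neg_simps)
    then have "inv\<^bsub>SL2Z\<^esub> A = A"
      using A mem by (intro inv_equality) auto
    then show "inv\<^bsub>SL2Z\<^esub> A \<in> pm_one" using A by simp
  qed (use mem in \<open>auto simp: pm_one_def matrix_neg_simps\<close>)
  show ?thesis
  proof (rule normalI[OF sub], intro ballI)
    fix A assume "A \<in> carrier SL2Z"
    show "pm_one #>\<^bsub>SL2Z\<^esub> A = A <#\<^bsub>SL2Z\<^esub> pm_one"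
      by (simp add: pm_one_def r_coset_def l_coset_def matrix_neg_simps)
  qed
qed

lemma group_PSL2Z: "group PSL2Z"
  unfolding PSL2Z_def by (rule normal.factorgroup_is_group[OF normal_pm_one])

lemma to_PSL2Z_hom: "to_PSL2Z \<in> hom SL2Z PSL2Z"
  using normal.r_coset_hom_Mod[OF normal_pm_one] by (simp add: PSL2Z_def to_PSL2Z_def[abs_def])

lemma to_PSL2Z_surj: "to_PSL2Z ` carrier SL2Z = carrier PSL2Z"
  by (auto simp: PSL2Z_def to_PSL2Z_def FactGroup_def RCOSETS_def)

end

(*
  A lift of the image of G, where -1 lies in G, is either G itself or the kernel of a character
  G -> {1, -1} with value -1 at -1. So one counts quadratic characters of G that are trivial on
  some Gamma(M). All three families have the form
    G = {(a, b; c, d) in SL2(Z) : R | b, N | c, a in U},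
  where U consists of full residue classes modulo K = R N forming a group of units (for Gamma(N)
  take R = N, so that K = N^2). Modulo M, an element with a = 1 + K z prime to M can be moved by
  powers of the unipotents u = (1, R; 0, 1) and l = (1, 0; N, 1) to u l^z. Hence a congruence
  character is determined by its values at u and l, which must agree when K is odd, and by
  a quadratic character of U modulo K; conversely all such data occur. What remains is to count
  the quadratic characters of U that are odd.
*)
theory Submission
  imports Defs "HOL-Number_Theory.Euler_Criterion" "HOL-Number_Theory.Residue_Primitive_Roots"
begin

section \<open>Real Dirichlet characters\<close>

text \<open>Why the modulus is R N: in a product of two matrices of the group the upper left entries
  multiply up to a term divisible by R N, so that entry modulo R N is a homomorphism. Working modulo
  N alone would lose characters of Gamma(N): for even N the map sending 1 + N u to the sign (-1)^u
  is well defined modulo N^2 but not modulo N. This is the origin of 9 in place of 5. The obstacle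
  is that the level M of a congruence character is unrelated to K, and that the upper left entry
  need not be prime to M. Since it is coprime to R c, multiplication by a suitable power of u makes
  it so. M is taken even, so that inverses modulo M are odd and the exponents of u and l are known
  modulo 2, which is all that a sign sees. The parity characters take the value 1 at -1, so oddness
  concerns the character of U alone: the number of lifts is 1, for G itself, plus the number of odd
  characters of U times 2 or 4, as K is odd or even. As soon as one odd real Dirichlet character
  exists, exactly half of them are odd.\<close>

definition real_chars :: "int \<Rightarrow> (int \<Rightarrow> int) set" where
  "real_chars N = {f. (\<forall>x. coprime x N \<longrightarrow> f x = 1 \<or> f x = -1) \<and> (\<forall>x. \<not> coprime x N \<longrightarrow> f x = 0)
     \<and> (\<forall>x y. f (x * y) = f x * f y) \<and> (\<forall>x y. [x = y] (mod N) \<longrightarrow> f x = f y)}"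

lemma real_charsD:
  assumes "f \<in> real_chars N"
  shows "coprime x N \<Longrightarrow> f x = 1 \<or> f x = -1" "\<not> coprime x N \<Longrightarrow> f x = 0"
    "f (x * y) = f x * f y" "[x = y] (mod N) \<Longrightarrow> f x = f y"
  using assms unfolding real_chars_def by blast+

lemma real_chars_one: "f \<in> real_chars N \<Longrightarrow> f 1 = 1"
  using real_charsD(1)[of f N 1] real_charsD(3)[of f N 1 1] by auto

lemma real_chars_square:
  assumes "f \<in> real_chars N" "coprime x N" shows "f (x * x) = 1"
  using real_charsD(1)[OF assms] real_charsD(3)[OF assms(1), of x x] by auto

lemma real_chars_cong_square:
  assumes "f \<in> real_chars N" "coprime x N" "[x = y * y] (mod N)" shows "f x = 1"
proof -
  have "coprime y N"
    using assms(2,3) by (metis cong_imp_coprime coprime_mult_left_iff)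
  then show ?thesis
    using real_charsD(4)[OF assms(1,3)] real_chars_square[OF assms(1)] by simp
qed

lemma real_chars_times:
  assumes "f \<in> real_chars M" "g \<in> real_chars N"
  shows "(\<lambda>x. f x * g x) \<in> real_chars (M * N)"
proof -
  have "f x * g x = f y * g y" if "[x = y] (mod M * N)" for x y
    using that real_charsD(4)[OF assms(1), of x y] real_charsD(4)[OF assms(2), of x y]
    by (metis cong_modulus_mult mult.commute)
  moreover have "f x * g x = 1 \<or> f x * g x = -1" if "coprime x (M * N)" for x
    using that real_charsD(1)[OF assms(1), of x] real_charsD(1)[OF assms(2), of x] by auto
  moreover have "f x * g x = 0" if "\<not> coprime x (M * N)" for x
    using that real_charsD(2)[OF assms(1), of x] real_charsD(2)[OF assms(2), of x] by auto
  ultimately show ?thesis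
    using real_charsD(3)[OF assms(1)] real_charsD(3)[OF assms(2)]
    unfolding real_chars_def by (auto simp: algebra_simps)
qed

lemma real_chars_times_same:
  assumes "f \<in> real_chars N" "g \<in> real_chars N"
  shows "(\<lambda>x. f x * g x) \<in> real_chars N"
proof -
  have "f x * g x = 1 \<or> f x * g x = -1" if "coprime x N" for x
    using that real_charsD(1)[OF assms(1), of x] real_charsD(1)[OF assms(2), of x] by auto
  then show ?thesis
    using assms unfolding real_chars_def by (auto simp: algebra_simps)
qed

lemma principal_real_char: "(\<lambda>x. if coprime x N then 1 else 0) \<in> real_chars N"
proof -
  have "coprime x N \<longleftrightarrow> coprime y N" if "[x = y] (mod N)" for x y
    using that by (metis cong_imp_coprime cong_sym)
  then show ?thesis unfolding real_chars_def by auto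
qed

text \<open>Chinese remainder theorem. With \<open>c u v\<close> a simultaneous solution of the two
  congruences, the component of \<open>h\<close> modulo \<open>M\<close> sends \<open>u\<close> to
  \<open>h (c u 1)\<close>; since \<open>x\<close> is congruent to \<open>c x 1 * c 1 x\<close>,
  \<open>h\<close> is the product of its two components.\<close>

lemma bij_betw_real_chars_mult:
  fixes M N :: int
  assumes "coprime M N"
  shows "bij_betw (\<lambda>(f, g) x. f x * g x) (real_chars M \<times> real_chars N) (real_chars (M * N))"
proof -
  define c where "c u v = (SOME x. [x = u] (mod M) \<and> [x = v] (mod N))" for u v
  have c: "[c u v = u] (mod M)" "[c u v = v] (mod N)" for u v
    using someI_ex[OF binary_chinese_remainder_int[OF assms, of u v]] unfolding c_def by auto
  have cm: "c u v mod M = u mod M" "c u v mod N = v mod N"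
    "c u v * c x y mod M = u * x mod M" "c u v * c x y mod N = v * y mod N" for u v x y
    using c cong_mult[OF c(1) c(1)] cong_mult[OF c(2) c(2)] by (auto simp: cong_def)
  have cu: "[x = y] (mod M * N)" if "[x = y] (mod M)" "[x = y] (mod N)" for x y
    using that assms by (simp add: coprime_cong_mult)
  have fc: "f (c u 1) = f u" if "f \<in> real_chars M" for f u
    using real_charsD(4)[OF that c(1)] .
  have gc: "g (c 1 u) = g u" if "g \<in> real_chars N" for g u
    using real_charsD(4)[OF that c(2)] .
  have f1: "f (c 1 u) = 1" if "f \<in> real_chars M" for f u
    using real_charsD(4)[OF that c(1)] real_chars_one[OF that] by simp
  have g1: "g (c u 1) = 1" if "g \<in> real_chars N" for g u
    using real_charsD(4)[OF that c(2)] real_chars_one[OF that] by simp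
  show ?thesis
  proof (rule bij_betw_imageI)
    show "inj_on (\<lambda>(f, g) x. f x * g x) (real_chars M \<times> real_chars N)"
    proof (rule inj_onI, clarify)
      fix f g f' g'
      assume m: "f \<in> real_chars M" "g \<in> real_chars N" "f' \<in> real_chars M" "g' \<in> real_chars N"
        and eq: "(\<lambda>x. f x * g x) = (\<lambda>x. f' x * g' x)"
      have "f u = f' u" for u
        using fun_cong[OF eq, of "c u 1"] fc[OF m(1)] fc[OF m(3)] g1[OF m(2)] g1[OF m(4)] by simp
      moreover have "g u = g' u" for u
        using fun_cong[OF eq, of "c 1 u"] gc[OF m(2)] gc[OF m(4)] f1[OF m(1)] f1[OF m(3)] by simp
      ultimately show "f = f' \<and> g = g'" by auto
    qed
    have "h \<in> (\<lambda>(f, g) x. f x * g x) ` (real_chars M \<times> real_chars N)"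
      if h: "h \<in> real_chars (M * N)" for h
    proof -
      have cop: "coprime x K \<longleftrightarrow> coprime y K" if "[x = y] (mod K)" for x y K :: int
        using that by (metis cong_imp_coprime cong_sym)
      have cop1: "coprime (c u 1) (M * N) \<longleftrightarrow> coprime u M" for u
        using cop[OF c(1)[of u 1]] cop[OF c(2)[of u 1]] by simp
      have cop2: "coprime (c 1 u) (M * N) \<longleftrightarrow> coprime u N" for u
        using cop[OF c(1)[of 1 u]] cop[OF c(2)[of 1 u]] by simp
      have "h (c (x * y) 1) = h (c x 1) * h (c y 1)" for x y
      proof -
        have "[c (x * y) 1 = c x 1 * c y 1] (mod M * N)"
          by (intro cu) (simp_all add: cong_def cm)
        then show ?thesis using real_charsD(3,4)[OF h] by metis
      qed
      moreover have "h (c x 1) = h (c y 1)" if "[x = y] (mod M)" for x y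
      proof -
        have "[c x 1 = c y 1] (mod M * N)"
          using that by (intro cu) (simp_all add: cong_def cm)
        then show ?thesis using real_charsD(4)[OF h] by metis
      qed
      ultimately have hf: "(\<lambda>x. h (c x 1)) \<in> real_chars M"
        unfolding real_chars_def using real_charsD(1,2)[OF h, of "c x 1" for x] cop1 by blast
      have "h (c 1 (x * y)) = h (c 1 x) * h (c 1 y)" for x y
      proof -
        have "[c 1 (x * y) = c 1 x * c 1 y] (mod M * N)"
          by (intro cu) (simp_all add: cong_def cm)
        then show ?thesis using real_charsD(3,4)[OF h] by metis
      qed
      moreover have "h (c 1 x) = h (c 1 y)" if "[x = y] (mod N)" for x y
      proof -
        have "[c 1 x = c 1 y] (mod M * N)"
          using that by (intro cu) (simp_all add: cong_def cm)
        then show ?thesis using real_charsD(4)[OF h] by metis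
      qed
      ultimately have hg: "(\<lambda>x. h (c 1 x)) \<in> real_chars N"
        unfolding real_chars_def using real_charsD(1,2)[OF h, of "c 1 x" for x] cop2 by blast
      have "h x = h (c x 1) * h (c 1 x)" for x
      proof -
        have "[x = c x 1 * c 1 x] (mod M * N)"
          by (intro cu) (simp_all add: cong_def cm)
        then show ?thesis using real_charsD(3,4)[OF h] by metis
      qed
      then have "h = (\<lambda>(f, g) x. f x * g x) (\<lambda>x. h (c x 1), \<lambda>x. h (c 1 x))"
        unfolding case_prod_conv by (rule ext)
      then show ?thesis by (rule image_eqI) (intro SigmaI hf hg)
    qed
    then show "(\<lambda>(f, g) x. f x * g x) ` (real_chars M \<times> real_chars N) = real_chars (M * N)"
      using real_chars_times by auto
  qed
qed

section \<open>Lowering the modulus of a real character\<close>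

lemma real_chars_reduce:
  fixes K m :: int
  assumes "\<And>x. coprime x (K * m) \<longleftrightarrow> coprime x K"
    and "\<And>f x. f \<in> real_chars (K * m) \<Longrightarrow> f (1 + K * x) = 1"
  shows "real_chars (K * m) = real_chars K"
proof (intro equalityI subsetI)
  fix f assume "f \<in> real_chars K"
  then show "f \<in> real_chars (K * m)"
    unfolding real_chars_def using assms(1) by (simp add: cong_modulus_mult)
next
  fix f assume f: "f \<in> real_chars (K * m)"
  have "f x = f y" if xy: "[x = y] (mod K)" for x y
  proof (cases "coprime x K")
    case True
    then obtain x' where x': "[x * x' = 1] (mod K * m)"
      using assms(1) cong_solve_coprime_int by blast
    obtain k where k: "y = x + K * k"
      using xy by (metis cong_iff_lin cong_sym)
    \<comment> \<open>With \<open>x'\<close> inverse to \<open>x\<close>, the unit \<open>y\<close>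
      is \<open>x\<close> times an element that is 1 modulo \<open>K\<close>; the second hypothesis
      says that \<open>f\<close> is 1 there.\<close>
    have "[x * (1 + K * (k * x')) = y] (mod K * m)"
    proof -
      have "[x + K * k * (x * x') = x + K * k * 1] (mod K * m)"
        by (intro cong_add cong_mult x') auto
      then show ?thesis by (simp add: k algebra_simps)
    qed
    then show ?thesis
      using real_charsD(3,4)[OF f] assms(2)[OF f] by (metis mult.right_neutral)
  next
    case False
    then have "\<not> coprime y K" using xy by (metis cong_imp_coprime cong_sym)
    then show ?thesis using False real_charsD(2)[OF f] assms(1) by simp
  qed
  then show "f \<in> real_chars K"
    using f assms(1) unfolding real_chars_def by simp
qed

lemma one_plus_power_cong: "[(1 + K * x) ^ n = 1 + int n * K * x] (mod K * K)" for K x :: int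
proof (induction n)
  case (Suc n)
  have "[(1 + K * x) * (1 + K * x) ^ n = (1 + K * x) * (1 + int n * K * x)] (mod K * K)"
    by (intro cong_mult Suc.IH cong_refl)
  moreover have "(1 + K * x) * (1 + int n * K * x) = 1 + int (Suc n) * K * x + K * K * (int n * x * x)"
    by (simp add: algebra_simps)
  ultimately show ?case by (simp add: cong_def)
qed auto

lemma real_chars_power:
  assumes "f \<in> real_chars N" shows "f (x ^ n) = f x ^ n"
  by (induction n) (auto simp: real_chars_one[OF assms] real_charsD(3)[OF assms])

text \<open>The \<open>p\<close>-th power of an element that is 1 modulo \<open>p ^ k\<close> is 1
  modulo \<open>p ^ (k + 1)\<close>. As \<open>p\<close> is odd, a sign whose \<open>p\<close>-th
  power is 1 is itself 1, so every character descends step by step to the modulus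
  \<open>p\<close>.\<close>

lemma real_chars_odd_prime_power:
  assumes "prime p" "odd p" "k \<ge> 1"
  shows "real_chars (int p ^ k) = real_chars (int p)"
  using assms(3)
proof (induction k rule: dec_induct)
  case (step k)
  have "real_chars (int p ^ k * int p) = real_chars (int p ^ k)"
  proof (rule real_chars_reduce)
    show "coprime x (int p ^ k * int p) \<longleftrightarrow> coprime x (int p ^ k)" for x
      using step.hyps by simp
    fix f x assume f: "f \<in> real_chars (int p ^ k * int p)"
    have "coprime (1 + int p * (int p ^ (k - 1) * x)) (int p)"
      by (rule cong_imp_coprime[of 1]) (simp_all add: cong_iff_dvd_diff)
    then have cop: "coprime (1 + int p ^ k * x) (int p ^ k * int p)"
      using step.hyps by (cases k) (auto simp: mult.assoc)
    have "int p ^ k * int p dvd int p ^ k * int p ^ k"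
      using step.hyps by (intro mult_dvd_mono) auto
    then have "[(1 + int p ^ k * x) ^ p = 1 + int p * int p ^ k * x] (mod int p ^ k * int p)"
      using one_plus_power_cong[of "int p ^ k" x p] cong_dvd_modulus by blast
    also have "[1 + int p * int p ^ k * x = 1] (mod int p ^ k * int p)"
      by (simp add: cong_iff_dvd_diff mult.commute)
    finally have "f (1 + int p ^ k * x) ^ p = 1"
      using real_charsD(4)[OF f] real_chars_power[OF f] real_chars_one[OF f] by metis
    then show "f (1 + int p ^ k * x) = 1"
      using real_charsD(1)[OF f cop] assms(2) by auto
  qed
  then show ?case using step.IH by (simp add: mult.commute)
qed auto

lemma real_chars_two_power:
  assumes "k \<ge> 3"
  shows "real_chars (2 ^ k) = real_chars 8"
  using assms
proof (induction k rule: dec_induct)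
  case (step k)
  have "real_chars (2 ^ k * 2) = real_chars (2 ^ k)"
  proof (rule real_chars_reduce)
    show "coprime x (2 ^ k * 2) \<longleftrightarrow> coprime x (2 ^ k)" for x :: int
      using step.hyps by simp
    fix f and x :: int assume f: "f \<in> real_chars (2 ^ k * 2)"
    \<comment> \<open>\<open>1 + 2 ^ k * x\<close> is a square modulo \<open>2 ^ (k + 1)\<close>, which fails for \<open>k < 3\<close>.\<close>
    obtain m where k: "k = m + 3" using step.hyps by (metis le_add_diff_inverse2)
    have "[1 + 2 ^ k * x = (1 + 2 ^ (k - 1) * x) * (1 + 2 ^ (k - 1) * x)] (mod 2 ^ k * 2)"
      unfolding cong_iff_dvd_diff k
      \<comment> \<open>The square exceeds the left side by \<open>2 ^ (2 * k - 2) * x * x\<close>,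
        and \<open>2 * k - 2 = (k + 1) + m\<close> for \<open>k = m + 3\<close>.\<close>
      by (rule dvdI[of _ _ "- (2 ^ m * x * x)"]) (simp add: power_add algebra_simps)
    moreover have "coprime (1 + 2 ^ k * x) (2 ^ k * 2)"
      using k by simp
    ultimately show "f (1 + 2 ^ k * x) = 1"
      using real_chars_cong_square[OF f] by blast
  qed
  then show ?case using step.IH by (simp add: mult.commute)
qed auto

section \<open>Real characters modulo 1, 2, 4 and 8\<close>

lemma real_chars_mono:
  fixes K m :: int
  assumes "\<And>x. coprime x (K * m) \<longleftrightarrow> coprime x K"
  shows "real_chars K \<subseteq> real_chars (K * m)"
  unfolding real_chars_def using assms by (auto simp: cong_modulus_mult)

lemma real_chars_1: "real_chars 1 = {\<lambda>x. 1}"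
proof -
  have "f = (\<lambda>x. 1)" if "f \<in> real_chars 1" for f
    using real_charsD(4)[OF that, of _ 1] real_chars_one[OF that] by auto
  moreover have "(\<lambda>x. 1) \<in> real_chars 1"
    using principal_real_char[of 1] by simp
  ultimately show ?thesis by blast
qed

lemma real_chars_2: "real_chars 2 = {\<lambda>x. if odd x then 1 else 0}"
proof -
  have "f x = (if odd x then 1 else 0)" if "f \<in> real_chars 2" for f x
  proof (cases "odd x")
    case True
    then have "[x = 1] (mod 2)" by (simp add: cong_def odd_iff_mod_2_eq_one)
    then show ?thesis using True real_charsD(4)[OF that, of x 1] real_chars_one[OF that] by simp
  next
    case False
    then show ?thesis using real_charsD(2)[OF that, of x] by simp
  qed
  then have "f = (\<lambda>x. if odd x then 1 else 0)" if "f \<in> real_chars 2" for f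
    using that by blast
  moreover have "(\<lambda>x. if odd x then 1 else 0) \<in> real_chars 2"
    using principal_real_char[of 2] by simp
  ultimately show ?thesis by blast
qed

text \<open>The units modulo 8 form a Klein four-group generated by 3 and 5, so the signs
  \<open>e\<close> at 3 and \<open>d\<close> at 5 are free and fix the value at 7.
  \<open>mod8_char (-1) 1\<close> is the odd character modulo 4.\<close>

definition mod8_char :: "int \<Rightarrow> int \<Rightarrow> int \<Rightarrow> int" where
  "mod8_char e d x = (if even x then 0 else if x mod 8 = 1 then 1 else if x mod 8 = 3 then e
     else if x mod 8 = 5 then d else e * d)"

lemma odd_mod_8: "odd x \<Longrightarrow> x mod 8 = 1 \<or> x mod 8 = 3 \<or> x mod 8 = 5 \<or> x mod 8 = 7" for x :: int
  by presburger

lemma coprime_4_8: "coprime x 4 \<longleftrightarrow> odd x" "coprime x 8 \<longleftrightarrow> odd x" for x :: int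
  using coprime_power_right_iff[of x 2 2] coprime_power_right_iff[of x 2 3] by auto

lemma mod8_char_mod: "mod8_char e d (x mod 8) = mod8_char e d x"
proof -
  have "even (x mod 8) \<longleftrightarrow> even x" by presburger
  then show ?thesis unfolding mod8_char_def by simp
qed

lemma mod8_char_in_real_chars:
  assumes "e = 1 \<or> e = -1" "d = 1 \<or> d = -1"
  shows "mod8_char e d \<in> real_chars 8"
proof -
  have d: "e * e = 1" "d * d = 1" "e * (e * z) = z" "d * (d * z) = z" for z
    using assms by auto
  have mult: "mod8_char e d (x * y) = mod8_char e d x * mod8_char e d y" for x y
  proof (cases "odd x \<and> odd y")
    case True
    have "\<forall>a\<in>{1, 3, 5, 7}. \<forall>b\<in>{1, 3, 5, 7}. mod8_char e d (a * b) = mod8_char e d a * mod8_char e d b"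
      by (simp add: mod8_char_def d ac_simps)
    then have "mod8_char e d ((x mod 8) * (y mod 8)) = mod8_char e d (x mod 8) * mod8_char e d (y mod 8)"
      using odd_mod_8[of x] odd_mod_8[of y] True by blast
    then show ?thesis by (metis mod8_char_mod mod_mult_eq)
  qed (auto simp: mod8_char_def)
  have "mod8_char e d x = mod8_char e d y" if "[x = y] (mod 8)" for x y
    using that mod8_char_mod unfolding cong_def by metis
  moreover have "coprime x 8 \<longrightarrow> mod8_char e d x = 1 \<or> mod8_char e d x = -1" "\<not> coprime x 8 \<longrightarrow> mod8_char e d x = 0" for x
    using assms by (auto simp: mod8_char_def coprime_4_8)
  ultimately show ?thesis
    using mult unfolding real_chars_def by blast
qed

lemma real_chars_8: "f \<in> real_chars 8 \<Longrightarrow> mod8_char (f 3) (f 5) = f"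
proof
  fix x assume f: "f \<in> real_chars 8"
  have "f 7 = f 15" by (rule real_charsD(4)[OF f]) (simp add: cong_def)
  also have "\<dots> = f 3 * f 5" using real_charsD(3)[OF f, of 3 5] by simp
  finally have f7: "f 7 = f 3 * f 5" .
  have "f x = f (x mod 8)" by (rule real_charsD(4)[OF f]) (simp add: cong_def)
  then show "mod8_char (f 3) (f 5) x = f x"
    using odd_mod_8[of x] real_charsD(2)[OF f, of x] coprime_4_8(2)[of x] f7 real_chars_one[OF f]
    unfolding mod8_char_def by (cases "odd x") auto
qed

lemma card_real_chars_8: "card (real_chars 8) = 4"
proof -
  have "bij_betw (\<lambda>f. (f 3, f 5)) (real_chars 8) ({1, -1} \<times> {1, -1})"
  proof (rule bij_betw_byWitness[where f' = "\<lambda>(e, d). mod8_char e d"])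
    show "(\<lambda>f. (f 3, f 5)) ` real_chars 8 \<subseteq> {1, -1} \<times> {1, -1}"
      using real_charsD(1)[of _ 8 3] real_charsD(1)[of _ 8 5]
      by (auto simp: coprime_4_8)
  qed (use real_chars_8 mod8_char_in_real_chars in \<open>auto simp: mod8_char_def\<close>)
  then show ?thesis by (simp add: bij_betw_same_card)
qed

lemma real_chars_4: "real_chars 4 = {mod8_char 1 1, mod8_char (-1) 1}"
proof (intro equalityI subsetI)
  fix f assume f: "f \<in> real_chars 4"
  have "coprime x (4 * 2) \<longleftrightarrow> coprime x 4" for x :: int
    using coprime_4_8 by simp
  then have "real_chars 4 \<subseteq> real_chars (4 * 2)" by (rule real_chars_mono)
  then have "mod8_char (f 3) (f 5) = f" using f real_chars_8[of f] by auto
  moreover have "f 5 = f 1" by (rule real_charsD(4)[OF f]) (simp add: cong_def)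
  moreover have "f 3 = 1 \<or> f 3 = -1"
    by (rule real_charsD(1)[OF f]) (simp add: coprime_4_8)
  ultimately show "f \<in> {mod8_char 1 1, mod8_char (-1) 1}" using real_chars_one[OF f] by (metis insertI1 insertI2)
next
  have "mod8_char e 1 \<in> real_chars 4" if e: "e = 1 \<or> e = -1" for e
  proof -
    have c1: "mod8_char e 1 x = (if even x then 0 else if x mod 4 = 1 then 1 else e)" for x
    proof -
      have "odd x \<Longrightarrow> (x mod 8 = 1 \<or> x mod 8 = 5) \<longleftrightarrow> x mod 4 = 1" by presburger
      then show ?thesis using odd_mod_8[of x] unfolding mod8_char_def by auto
    qed
    have "mod8_char e 1 x = mod8_char e 1 y" if "[x = y] (mod 4)" for x y
    proof -
      have "even x \<longleftrightarrow> even y"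
        using cong_dvd_modulus[OF that, of 2] by (simp add: cong_def even_iff_mod_2_eq_zero)
      moreover have "x mod 4 = y mod 4" using that by (simp add: cong_def)
      ultimately show ?thesis unfolding c1 by presburger
    qed
    moreover have "coprime x 4 \<longleftrightarrow> coprime x 8" for x :: int
      using coprime_4_8 by simp
    ultimately show ?thesis
      using mod8_char_in_real_chars[OF e, of 1] unfolding real_chars_def by simp
  qed
  then show "f \<in> real_chars 4" if "f \<in> {mod8_char 1 1, mod8_char (-1) 1}" for f
    using that by blast
qed

lemma card_real_chars_4: "card (real_chars 4) = 2"
proof -
  have "mod8_char 1 1 3 \<noteq> mod8_char (-1) 1 3" by (simp add: mod8_char_def)
  then have "mod8_char 1 1 \<noteq> mod8_char (-1) 1" by metis
  then show ?thesis by (simp add: real_chars_4)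
qed

text \<open>The number of independent real characters modulo \<open>2 ^ s\<close> is 0, 0, 1, 2 for
  s = 0, 1, 2, 3 and stays 2. Oddness first becomes possible with the character modulo 4.\<close>

lemma real_chars_two_power_cases:
  shows "card (real_chars (2 ^ s)) = 2 ^ (if s \<le> 1 then 0 else min 3 s - 1)"
    and "s \<le> 1 \<Longrightarrow> f \<in> real_chars (2 ^ s) \<Longrightarrow> f (-1) = 1"
    and "s \<ge> 2 \<Longrightarrow> mod8_char (-1) 1 \<in> real_chars (2 ^ s)"
proof -
  consider "s = 0" | "s = 1" | "s = 2" | "s \<ge> 3" by linarith
  then have "card (real_chars (2 ^ s)) = 2 ^ (if s \<le> 1 then 0 else min 3 s - 1)
    \<and> (s \<le> 1 \<longrightarrow> f \<in> real_chars (2 ^ s) \<longrightarrow> f (-1) = 1)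
    \<and> (s \<ge> 2 \<longrightarrow> mod8_char (-1) 1 \<in> real_chars (2 ^ s))"
  proof cases
    case 4
    then have "min 3 s - 1 = 2" by simp
    then show ?thesis
      using 4 card_real_chars_8 mod8_char_in_real_chars by (simp add: real_chars_two_power)
  qed (use card_real_chars_4 in \<open>simp_all add: real_chars_1 real_chars_2 real_chars_4\<close>)
  then show "card (real_chars (2 ^ s)) = 2 ^ (if s \<le> 1 then 0 else min 3 s - 1)"
    and "s \<le> 1 \<Longrightarrow> f \<in> real_chars (2 ^ s) \<Longrightarrow> f (-1) = 1"
    and "s \<ge> 2 \<Longrightarrow> mod8_char (-1) 1 \<in> real_chars (2 ^ s)" by blast+
qed

section \<open>Quadratic characters modulo an odd prime\<close>

lemma int_eq_0_if_dvd_small: "n dvd z \<Longrightarrow> \<bar>z\<bar> < n \<Longrightarrow> z = 0" for n z :: int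
  using dvd_imp_le_int[of z n] by linarith

text \<open>Euler's criterion gives the identity modulo \<open>p\<close>. Both sides lie in {-1, 0,
  1}, so their difference is at most 2 in absolute value and a multiple of \<open>p > 2\<close>,
  hence zero.\<close>

lemma Legendre_mult:
  assumes "prime p" "odd p"
  shows "Legendre (x * y) (int p) = Legendre x (int p) * Legendre y (int p)"
proof -
  have p: "2 < p" using assms prime_ge_2_nat[of p] by (cases "p = 2") auto
  note e = euler_criterion[OF assms(1) p]
  have "[Legendre (x * y) (int p) = (x * y) ^ ((p - 1) div 2)] (mod int p)" by (rule e)
  also have "[(x * y) ^ ((p - 1) div 2) = Legendre x (int p) * Legendre y (int p)] (mod int p)"
    unfolding power_mult_distrib by (intro cong_mult cong_sym[OF e])
  finally have "int p dvd Legendre (x * y) (int p) - Legendre x (int p) * Legendre y (int p)"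
    by (simp add: cong_iff_dvd_diff)
  moreover have "\<bar>Legendre (x * y) (int p) - Legendre x (int p) * Legendre y (int p)\<bar> < int p"
    using p by (auto simp: Legendre_def)
  ultimately show ?thesis
    using int_eq_0_if_dvd_small right_minus_eq by blast
qed

lemma Legendre_in_real_chars:
  assumes "prime p" "odd p"
  shows "(\<lambda>x. Legendre x (int p)) \<in> real_chars (int p)"
proof -
  have cop: "coprime x (int p) \<longleftrightarrow> \<not> [x = 0] (mod int p)" for x
  proof
    assume "coprime x (int p)"
    then show "\<not> [x = 0] (mod int p)"
      using assms(1) coprime_common_divisor[of x "int p" "int p"] by (auto simp: cong_0_iff)
  next
    assume "\<not> [x = 0] (mod int p)"
    then show "coprime x (int p)"
      using assms(1) prime_imp_coprime[of "int p" x] by (simp add: cong_0_iff coprime_commute)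
  qed
  have "Legendre x (int p) = Legendre y (int p)" if "[x = y] (mod int p)" for x y
  proof -
    have "[x = 0] (mod int p) \<longleftrightarrow> [y = 0] (mod int p)"
      using that by (meson cong_sym cong_trans)
    moreover have "QuadRes (int p) x \<longleftrightarrow> QuadRes (int p) y"
      unfolding QuadRes_def using that by (meson cong_sym cong_trans)
    ultimately show ?thesis by (simp add: Legendre_def)
  qed
  moreover have "coprime x (int p) \<longrightarrow> Legendre x (int p) = 1 \<or> Legendre x (int p) = -1"
    "\<not> coprime x (int p) \<longrightarrow> Legendre x (int p) = 0" for x
    by (simp_all add: cop Legendre_def)
  ultimately show ?thesis
    unfolding real_chars_def using Legendre_mult[OF assms] by blast
qed

text \<open>A primitive root works: its order is \<open>p - 1\<close>, so its power with exponent
  \<open>(p - 1) div 2\<close> is not 1, which by Euler's criterion excludes the Legendre symbol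
  1.\<close>

lemma ex_nonresidue:
  assumes "prime p" "odd p"
  shows "\<exists>g. Legendre g (int p) = -1"
proof -
  have p: "2 < p" using assms prime_ge_2_nat[of p] by (cases "p = 2") auto
  obtain g where g: "residue_primroot p g"
    using prime_primitive_root_exists[of p] assms prime_gt_1_nat[of p] by auto
  have "ord p g = p - 1" "coprime p g"
    using g assms(1) by (simp_all add: residue_primroot_def totient_prime)
  then have "\<not> [g ^ ((p - 1) div 2) = 1] (mod p)"
    using p ord_minimal[of "(p - 1) div 2" p g] by simp
  then have "\<not> [int g ^ ((p - 1) div 2) = 1] (mod int p)"
    by (metis cong_int_iff of_nat_1 of_nat_power)
  then have "Legendre (int g) (int p) \<noteq> 1"
    using euler_criterion[OF assms(1) p, of "int g"] by (metis cong_sym)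
  moreover have "\<not> [int g = 0] (mod int p)"
  proof
    assume "[int g = 0] (mod int p)"
    then have "p dvd g" by (simp add: cong_0_iff)
    then show False using \<open>coprime p g\<close> p by (simp add: coprime_absorb_left)
  qed
  ultimately show ?thesis by (auto simp: Legendre_def split: if_splits)
qed

text \<open>A real character is 1 on unit squares. If it is -1 at some \<open>n\<close>, then
  \<open>n\<close> is a nonresidue, and the product of \<open>n\<close> with any nonresidue is a
  residue, so the character agrees with the Legendre symbol.\<close>

lemma real_chars_odd_prime:
  assumes "prime p" "odd p"
  shows "real_chars (int p) = {\<lambda>x. if coprime x (int p) then 1 else 0, \<lambda>x. Legendre x (int p)}"
proof (intro equalityI subsetI)
  fix f assume f: "f \<in> real_chars (int p)"
  note L = Legendre_in_real_chars[OF assms]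
  have res: "f x = 1" if "Legendre x (int p) = 1" for x
  proof -
    have "QuadRes (int p) x" using that by (simp add: Legendre_def split: if_splits)
    then obtain y where "[x = y * y] (mod int p)"
      unfolding QuadRes_def power2_eq_square using cong_sym by blast
    moreover have "coprime x (int p)" using that real_charsD(2)[OF L, of x] by force
    ultimately show ?thesis using real_chars_cong_square[OF f] by blast
  qed
  show "f \<in> {\<lambda>x. if coprime x (int p) then 1 else 0, \<lambda>x. Legendre x (int p)}"
  proof (cases "\<forall>x. coprime x (int p) \<longrightarrow> f x = 1")
    case True
    then have "f x = (if coprime x (int p) then 1 else 0)" for x
      using real_charsD(2)[OF f, of x] by auto
    then show ?thesis by blast
  next
    case False
    then obtain n where n: "coprime n (int p)" "f n = -1"
      using real_charsD(1)[OF f] by blast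
    have Ln: "Legendre n (int p) = -1"
      using real_charsD(1)[OF L n(1)] res[of n] n(2) by auto
    have "f x = Legendre x (int p)" for x
    proof (cases "Legendre x (int p) = -1")
      case True
      then have "f (x * n) = 1" using Ln by (intro res) (simp add: Legendre_mult[OF assms])
      then show ?thesis using True n(2) by (simp add: real_charsD(3)[OF f])
    next
      case False
      then show ?thesis
        using res[of x] real_charsD(1)[OF L, of x] real_charsD(2)[OF f, of x] real_charsD(2)[OF L, of x]
        by (cases "coprime x (int p)") auto
    qed
    then show ?thesis by blast
  qed
next
  fix f assume "f \<in> {\<lambda>x. if coprime x (int p) then 1 else 0, \<lambda>x. Legendre x (int p)}"
  then show "f \<in> real_chars (int p)"
    using principal_real_char[of "int p"] Legendre_in_real_chars[OF assms] by blast
qed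

lemma card_real_chars_odd_prime:
  assumes "prime p" "odd p"
  shows "card (real_chars (int p)) = 2"
proof -
  have "(\<lambda>x. if coprime x (int p) then 1 else 0) \<noteq> (\<lambda>x. Legendre x (int p))"
    using ex_nonresidue[OF assms] by (metis one_neq_neg_one zero_neq_neg_one)
  then show ?thesis by (simp add: real_chars_odd_prime[OF assms])
qed

lemma Legendre_minus_one:
  assumes "prime p" "odd p"
  shows "Legendre (-1) (int p) = (if [p = 1] (mod 4) then 1 else -1)"
proof -
  have p: "2 < p" using assms prime_ge_2_nat[of p] by (cases "p = 2") auto
  have "[p = 1] (mod 4) \<longleftrightarrow> even ((p - 1) div 2)"
    using assms(2) p unfolding cong_def by presburger
  then have eq: "(-1) ^ ((p - 1) div 2) = (if [p = 1] (mod 4) then 1 else -1 :: int)"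
    by simp
  have "[Legendre (-1) (int p) = (-1) ^ ((p - 1) div 2)] (mod int p)"
    by (rule euler_criterion[OF assms(1) p])
  then have "int p dvd Legendre (-1) (int p) - (if [p = 1] (mod 4) then 1 else -1)"
    unfolding eq cong_iff_dvd_diff .
  moreover have "\<bar>Legendre (-1) (int p) - (if [p = 1] (mod 4) then 1 else -1)\<bar> < int p"
    using p by (auto simp: Legendre_def)
  ultimately show ?thesis
    using int_eq_0_if_dvd_small right_minus_eq by blast
qed

section \<open>Counting real characters and the odd ones among them\<close>

lemma card_real_chars_mult:
  "coprime M N \<Longrightarrow> card (real_chars (M * N)) = card (real_chars M) * card (real_chars N)" for M N :: int
  using bij_betw_same_card[OF bij_betw_real_chars_mult[of M N]] by (simp add: card_cartesian_product)

lemma real_chars_mult_decompose: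
  fixes M N :: int
  assumes "coprime M N" "h \<in> real_chars (M * N)"
  obtains f g where "f \<in> real_chars M" "g \<in> real_chars N" "h = (\<lambda>x. f x * g x)"
proof -
  have "h \<in> (\<lambda>(f, g) x. f x * g x) ` (real_chars M \<times> real_chars N)"
    using bij_betw_imp_surj_on[OF bij_betw_real_chars_mult[OF assms(1)]] assms(2) by simp
  then obtain w where w: "w \<in> real_chars M \<times> real_chars N" "h = (\<lambda>(f, g) x. f x * g x) w"
    by (rule imageE)
  obtain f g where "w = (f, g)" by fastforce
  then show ?thesis using w by (intro that[of f g]) simp_all
qed

text \<open>Each odd prime doubles the number of characters, whatever its exponent. The value at -1
  is the product of the local values: the Legendre symbol is -1 there exactly for primes that are 3
  modulo 4, and modulo \<open>2 ^ s\<close> an odd character exists exactly for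
  \<open>s \<ge> 2\<close>. One odd local character, padded by principal characters at the other
  primes, is odd.\<close>

lemma real_chars_factorization:
  fixes p e :: "nat \<Rightarrow> nat" and s t :: nat
  assumes "\<forall>i<t. prime (p i) \<and> odd (p i)" "inj_on p {..<t}" "\<forall>i<t. e i \<ge> 1"
  defines "N \<equiv> 2 ^ s * (\<Prod>i<t. int (p i) ^ e i)"
  shows "card (real_chars N) = 2 ^ (t + (if s \<le> 1 then 0 else min 3 s - 1))"
    and "s \<le> 1 \<Longrightarrow> \<forall>i<t. [p i = 1] (mod 4) \<Longrightarrow> \<forall>f\<in>real_chars N. f (-1) = 1"
    and "s \<ge> 2 \<or> (\<exists>i<t. [p i = 3] (mod 4)) \<Longrightarrow> \<exists>f\<in>real_chars N. f (-1) = -1"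
proof -
  have "card (real_chars N) = 2 ^ (t + (if s \<le> 1 then 0 else min 3 s - 1))
    \<and> (s \<le> 1 \<longrightarrow> (\<forall>i<t. [p i = 1] (mod 4)) \<longrightarrow> (\<forall>f\<in>real_chars N. f (-1) = 1))
    \<and> (s \<ge> 2 \<or> (\<exists>i<t. [p i = 3] (mod 4)) \<longrightarrow> (\<exists>f\<in>real_chars N. f (-1) = -1))"
    using assms(1-3) unfolding N_def
  proof (induction t)
    case 0
    have "mod8_char (-1) 1 (-1) = -1" by (simp add: mod8_char_def)
    then show ?case using real_chars_two_power_cases[of s] by auto
  next
    case (Suc t)
    define P where "P = 2 ^ s * (\<Prod>i<t. int (p i) ^ e i)"
    have p: "prime (p t)" "odd (p t)" "e t \<ge> 1" using Suc.prems by auto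
    note red = real_chars_odd_prime_power[OF p]
    have "coprime (int (p i)) (int (p t))" if "i < t" for i
    proof -
      have "p i \<noteq> p t" using inj_onD[OF Suc.prems(2), of i t] that by auto
      then show ?thesis using Suc.prems(1) that p(1) primes_coprime[of "p i" "p t"] by simp
    qed
    then have "coprime (\<Prod>i<t. int (p i) ^ e i) (int (p t) ^ e t)"
      by (intro prod_coprime_left) auto
    then have cop: "coprime P (int (p t) ^ e t)"
      unfolding P_def using p by simp
    have PS: "2 ^ s * (\<Prod>i<Suc t. int (p i) ^ e i) = P * int (p t) ^ e t"
      by (simp add: P_def)
    have pre: "\<forall>i<t. prime (p i) \<and> odd (p i)" "inj_on p {..<t}" "\<forall>i<t. e i \<ge> 1"
      using Suc.prems inj_on_subset[OF Suc.prems(2)] by auto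
    have IH: "card (real_chars P) = 2 ^ (t + (if s \<le> 1 then 0 else min 3 s - 1))"
      "s \<le> 1 \<Longrightarrow> \<forall>i<t. [p i = 1] (mod 4) \<Longrightarrow> \<forall>f\<in>real_chars P. f (-1) = 1"
      "s \<ge> 2 \<or> (\<exists>i<t. [p i = 3] (mod 4)) \<Longrightarrow> \<exists>f\<in>real_chars P. f (-1) = -1"
      using Suc.IH[OF pre] unfolding P_def by blast+
    have "card (real_chars (P * int (p t) ^ e t)) = 2 ^ (Suc t + (if s \<le> 1 then 0 else min 3 s - 1))"
      using card_real_chars_mult[OF cop] IH(1) card_real_chars_odd_prime[OF p(1,2)] red by simp
    moreover have "f (-1) = 1"
      if s: "s \<le> 1" "\<forall>i<Suc t. [p i = 1] (mod 4)" and f: "f \<in> real_chars (P * int (p t) ^ e t)" for f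
    proof -
      obtain g h where gh: "g \<in> real_chars P" "h \<in> real_chars (int (p t) ^ e t)" "f = (\<lambda>x. g x * h x)"
        using real_chars_mult_decompose[OF cop f] by blast
      have "h (-1) = 1"
        using gh(2) s(2) Legendre_minus_one[OF p(1,2)]
        unfolding red real_chars_odd_prime[OF p(1,2)] by auto
      then show ?thesis using gh IH(2) s by simp
    qed
    moreover have "\<exists>f\<in>real_chars (P * int (p t) ^ e t). f (-1) = -1"
      if ex: "s \<ge> 2 \<or> (\<exists>i<Suc t. [p i = 3] (mod 4))"
    proof -
      consider "s \<ge> 2 \<or> (\<exists>i<t. [p i = 3] (mod 4))" | "[p t = 3] (mod 4)"
        using ex by (auto simp: less_Suc_eq)
      then show ?thesis
      proof cases
        case 1
        then obtain g where "g \<in> real_chars P" "g (-1) = -1" using IH(3) by blast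
        then show ?thesis
          using real_chars_times[OF _ principal_real_char, of g P "int (p t) ^ e t"]
          by (intro bexI[of _ "\<lambda>x. g x * (if coprime x (int (p t) ^ e t) then 1 else 0)"]) auto
      next
        case 2
        have "(\<lambda>x. Legendre x (int (p t))) \<in> real_chars (int (p t) ^ e t)"
          unfolding red by (rule Legendre_in_real_chars[OF p(1,2)])
        moreover have "Legendre (-1) (int (p t)) = -1"
          using 2 Legendre_minus_one[OF p(1,2)] by (simp add: cong_def)
        ultimately show ?thesis
          using real_chars_times[OF principal_real_char[of P], of "\<lambda>x. Legendre x (int (p t))" "int (p t) ^ e t"]
          by (intro bexI[of _ "\<lambda>x. (if coprime x P then 1 else 0) * Legendre x (int (p t))"]) auto
      qed
    qed
    ultimately show ?case unfolding PS by blast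
  qed
  then show "card (real_chars N) = 2 ^ (t + (if s \<le> 1 then 0 else min 3 s - 1))"
    and "s \<le> 1 \<Longrightarrow> \<forall>i<t. [p i = 1] (mod 4) \<Longrightarrow> \<forall>f\<in>real_chars N. f (-1) = 1"
    and "s \<ge> 2 \<or> (\<exists>i<t. [p i = 3] (mod 4)) \<Longrightarrow> \<exists>f\<in>real_chars N. f (-1) = -1"
    by blast+
qed

text \<open>Multiplication by the odd character \<open>g\<close> is an involution that exchanges odd
  and even characters.\<close>

lemma card_odd_real_chars:
  assumes "g \<in> real_chars N" "g (-1) = -1" "finite (real_chars N)"
  shows "card (real_chars N) = 2 * card {f \<in> real_chars N. f (-1) = -1}"
proof -
  let ?O = "{f \<in> real_chars N. f (-1) = -1}" and ?E = "{f \<in> real_chars N. f (-1) = 1}"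
  have inv: "(\<lambda>x. g x * (g x * f x)) = f" if "f \<in> real_chars N" for f
  proof
    fix x show "g x * (g x * f x) = f x"
      using real_charsD(1)[OF assms(1), of x] real_charsD(2)[OF that, of x]
      by (cases "coprime x N") auto
  qed
  have "bij_betw (\<lambda>f x. g x * f x) ?O ?E"
    by (rule bij_betw_byWitness[where f' = "\<lambda>f x. g x * f x"])
      (use inv real_chars_times_same[OF assms(1)] assms(2) in auto)
  moreover have "f (-1) = 1 \<or> f (-1) = -1" if "f \<in> real_chars N" for f
    using real_charsD(1)[OF that, of "-1"] by simp
  then have "real_chars N = ?O \<union> ?E" by blast
  then have "card (real_chars N) = card ?O + card ?E"
    using assms(3) by (subst \<open>real_chars N = _\<close>, intro card_Un_disjoint) auto
  ultimately show ?thesis by (simp add: bij_betw_same_card)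
qed

section \<open>Congruence lifts and congruence characters\<close>

definition mat2 :: "int \<Rightarrow> int \<Rightarrow> int \<Rightarrow> int \<Rightarrow> int^2^2" where
  "mat2 a b c d = vector [vector [a, b], vector [c, d]]"

lemma mat2_nth [simp]:
  "mat2 a b c d $ 1 $ 1 = a" "mat2 a b c d $ 1 $ 2 = b"
  "mat2 a b c d $ 2 $ 1 = c" "mat2 a b c d $ 2 $ 2 = d"
  by (simp_all add: mat2_def)

lemma mat2_eqI:
  fixes A B :: "int^2^2"
  assumes "A $ 1 $ 1 = B $ 1 $ 1" "A $ 1 $ 2 = B $ 1 $ 2" "A $ 2 $ 1 = B $ 2 $ 1" "A $ 2 $ 2 = B $ 2 $ 2"
  shows "A = B"
  using assms by (simp add: vec_eq_iff forall_2)

lemma mult_nth [simp]: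
  fixes A B :: "int^2^2"
  shows "(A ** B) $ i $ j = A $ i $ 1 * B $ 1 $ j + A $ i $ 2 * B $ 2 $ j"
  by (simp add: matrix_matrix_mult_def sum_2)

lemma one_nth [simp]:
  "(mat 1 :: int^2^2) $ 1 $ 1 = 1" "(mat 1 :: int^2^2) $ 1 $ 2 = 0"
  "(mat 1 :: int^2^2) $ 2 $ 1 = 0" "(mat 1 :: int^2^2) $ 2 $ 2 = 1"
  by (simp_all add: mat_def)

lemma det_eq: "det A = A $ 1 $ 1 * A $ 2 $ 2 - A $ 1 $ 2 * A $ 2 $ 1" for A :: "int^2^2"
  by (rule det_2)

lemma mem_Gamma:
  "A \<in> Gamma M \<longleftrightarrow> det A = 1 \<and> [A $ 1 $ 1 = 1] (mod int M) \<and> [A $ 1 $ 2 = 0] (mod int M)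
    \<and> [A $ 2 $ 1 = 0] (mod int M) \<and> [A $ 2 $ 2 = 1] (mod int M)"
  by (auto simp: Gamma_def forall_2)

lemma Gamma_antimono: "M dvd M' \<Longrightarrow> Gamma M' \<subseteq> Gamma M"
  using cong_dvd_modulus[of _ _ "int M'" "int M"] by (auto simp: mem_Gamma)

text \<open>\<open>X\<close> is \<open>A\<close> times the adjugate of \<open>B\<close>; modulo
  \<open>M\<close> this is \<open>B\<close> times its own adjugate, the identity.\<close>

lemma Gamma_quotient:
  fixes A B :: "int^2^2"
  assumes "det A = 1" "det B = 1" "\<And>i j. [A $ i $ j = B $ i $ j] (mod int M)"
  obtains X where "X \<in> Gamma M" "A = X ** B"
proof
  define B' where "B' = mat2 (B $ 2 $ 2) (- B $ 1 $ 2) (- B $ 2 $ 1) (B $ 1 $ 1)"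
  have B': "det B' = 1" "B' ** B = mat 1" "B ** B' = mat 1"
    using assms(2) by (auto simp: B'_def det_eq algebra_simps intro!: mat2_eqI)
  show "A = (A ** B') ** B"
    by (simp add: B' flip: matrix_mul_assoc)
  have "[(A ** B') $ i $ j = (B ** B') $ i $ j] (mod int M)" for i j
    by (simp only: mult_nth) (intro cong_add cong_mult assms(3) cong_refl)
  then show "A ** B' \<in> Gamma M"
    unfolding B'(3) using B'(1) assms(1) by (simp add: Gamma_def det_mul)
qed

lemma minus_mat_1: "(- mat 1) ** A = - A" for A :: "int^2^2"
  by (simp add: matrix_neg_simps)

lemma subgroup_SL2Z_D:
  assumes "subgroup H SL2Z"
  shows "A \<in> H \<Longrightarrow> det A = 1" "mat 1 \<in> H" "A \<in> H \<Longrightarrow> B \<in> H \<Longrightarrow> A ** B \<in> H"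
  using subgroup.mem_carrier[OF assms] subgroup.one_closed[OF assms] subgroup.m_closed[OF assms]
  by auto

lemma subgroup_SL2Z_I:
  assumes "\<And>A. A \<in> H \<Longrightarrow> det A = 1" "mat 1 \<in> H" "\<And>A B. A \<in> H \<Longrightarrow> B \<in> H \<Longrightarrow> A ** B \<in> H"
    and "\<And>A. A \<in> H \<Longrightarrow> mat2 (A $ 2 $ 2) (- A $ 1 $ 2) (- A $ 2 $ 1) (A $ 1 $ 1) \<in> H"
  shows "subgroup H SL2Z"
proof (rule group.subgroupI[OF group_SL2Z])
  fix A assume "A \<in> H"
  then have "inv\<^bsub>SL2Z\<^esub> A = mat2 (A $ 2 $ 2) (- A $ 1 $ 2) (- A $ 2 $ 1) (A $ 1 $ 1)"
    using assms(1)[of A]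
    by (intro group.inv_equality[OF group_SL2Z]) (auto simp: det_eq algebra_simps intro!: mat2_eqI)
  then show "inv\<^bsub>SL2Z\<^esub> A \<in> H" using assms(4) \<open>A \<in> H\<close> by simp
qed (use assms in auto)

section \<open>Images in \<open>PSL2Z\<close> and finiteness of the index\<close>

lemma to_PSL2Z_eq: "to_PSL2Z A = {A, - A}"
  by (auto simp: to_PSL2Z_def r_coset_def pm_one_def minus_mat_1)

lemma to_PSL2Z_image_eq_iff:
  "to_PSL2Z ` H = to_PSL2Z ` K \<longleftrightarrow> (\<forall>A. A \<in> H \<or> - A \<in> H \<longleftrightarrow> A \<in> K \<or> - A \<in> K)"
proof -
  have c: "to_PSL2Z A \<in> to_PSL2Z ` H \<longleftrightarrow> A \<in> H \<or> - A \<in> H" for A H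
    by (auto simp: to_PSL2Z_eq image_iff doubleton_eq_iff) (metis minus_equation_iff)+
  show ?thesis
  proof
    assume "to_PSL2Z ` H = to_PSL2Z ` K"
    then show "\<forall>A. A \<in> H \<or> - A \<in> H \<longleftrightarrow> A \<in> K \<or> - A \<in> K" by (simp flip: c)
  next
    assume "\<forall>A. A \<in> H \<or> - A \<in> H \<longleftrightarrow> A \<in> K \<or> - A \<in> K"
    then have "to_PSL2Z ` H \<subseteq> to_PSL2Z ` K" "to_PSL2Z ` K \<subseteq> to_PSL2Z ` H"
      unfolding image_subset_iff c by blast+
    then show "to_PSL2Z ` H = to_PSL2Z ` K" by blast
  qed
qed

lemma finite_image_if_factors:
  assumes "finite (g ` S)" "\<And>x y. x \<in> S \<Longrightarrow> y \<in> S \<Longrightarrow> g x = g y \<Longrightarrow> f x = f y"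
  shows "finite (f ` S)"
proof (rule finite_surj[OF assms(1)])
  show "f ` S \<subseteq> (\<lambda>z. f (inv_into S g z)) ` g ` S"
  proof
    fix y assume "y \<in> f ` S"
    then obtain x where x: "x \<in> S" "y = f x" by blast
    then have "f (inv_into S g (g x)) = f x"
      by (intro assms(2) inv_into_into f_inv_into_f) auto
    then show "y \<in> (\<lambda>z. f (inv_into S g z)) ` g ` S"
      using x by (intro image_eqI[of _ _ "g x"]) auto
  qed
qed

text \<open>The entries modulo \<open>M\<close> take finitely many values and determine the coset,
  since matrices that agree modulo \<open>M\<close> differ by a left factor in
  \<open>Gamma M\<close>.\<close>

lemma finite_rcosets_congruence:
  assumes H: "subgroup H SL2Z" and M: "M \<ge> 1" "Gamma M \<subseteq> H"
  shows "finite (rcosets\<^bsub>SL2Z\<^esub> H)"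
proof -
  let ?g = "\<lambda>A :: int^2^2. ((A $ 1 $ 1 mod int M, A $ 1 $ 2 mod int M), (A $ 2 $ 1 mod int M, A $ 2 $ 2 mod int M))"
  have "?g ` carrier SL2Z \<subseteq> ({0..<int M} \<times> {0..<int M}) \<times> ({0..<int M} \<times> {0..<int M})"
    using M by auto
  then have "finite (?g ` carrier SL2Z)"
    by (rule finite_subset) auto
  then have "finite ((\<lambda>A. H #>\<^bsub>SL2Z\<^esub> A) ` carrier SL2Z)"
  proof (rule finite_image_if_factors)
    fix A B assume AB: "A \<in> carrier SL2Z" "B \<in> carrier SL2Z" "?g A = ?g B"
    then have "\<forall>i j. [A $ i $ j = B $ i $ j] (mod int M)"
      by (simp add: forall_2 cong_def)
    then obtain X where "X \<in> Gamma M" "A = X ** B"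
      using AB Gamma_quotient[of A B M] by auto
    then have "A \<in> H #>\<^bsub>SL2Z\<^esub> B"
      using M by (auto simp: r_coset_def)
    then show "H #>\<^bsub>SL2Z\<^esub> A = H #>\<^bsub>SL2Z\<^esub> B"
      using group.repr_independence[OF group_SL2Z _ AB(2) H] by simp
  qed
  moreover have "rcosets\<^bsub>SL2Z\<^esub> H = (\<lambda>A. H #>\<^bsub>SL2Z\<^esub> A) ` carrier SL2Z"
    unfolding RCOSETS_def by blast
  ultimately show ?thesis by simp
qed

lemma mem_congruence_lifts:
  "H \<in> congruence_lifts D \<longleftrightarrow> subgroup H SL2Z \<and> to_PSL2Z ` H = D \<and> (\<exists>M\<ge>1. Gamma M \<subseteq> H)"
  unfolding congruence_lifts_def is_lift_def congruence_subgroup_def mem_Collect_eq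
  using finite_rcosets_congruence[of H] by metis

text \<open>The value 0 off \<open>G\<close> makes equality of functions the same as equality of
  characters, so that \<open>card\<close> counts characters, and lets
  \<open>{A. \<psi> A = 1}\<close> denote the kernel.\<close>

definition congruence_chars :: "(int^2^2) set \<Rightarrow> (int^2^2 \<Rightarrow> int) set" where
  "congruence_chars G = {\<psi>. (\<forall>A\<in>G. \<psi> A = 1 \<or> \<psi> A = -1) \<and> (\<forall>A. A \<notin> G \<longrightarrow> \<psi> A = 0)
     \<and> (\<forall>A\<in>G. \<forall>B\<in>G. \<psi> (A ** B) = \<psi> A * \<psi> B) \<and> (\<exists>M\<ge>1. \<forall>A\<in>Gamma M. \<psi> A = 1)}"

lemma congruence_charsD:
  assumes "\<psi> \<in> congruence_chars G"
  shows "A \<in> G \<Longrightarrow> \<psi> A = 1 \<or> \<psi> A = -1" "A \<notin> G \<Longrightarrow> \<psi> A = 0"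
    "A \<in> G \<Longrightarrow> B \<in> G \<Longrightarrow> \<psi> (A ** B) = \<psi> A * \<psi> B" "\<exists>M\<ge>1. \<forall>A\<in>Gamma M. \<psi> A = 1"
  using assms unfolding congruence_chars_def by blast+

lemma mat_1_in_Gamma: "mat 1 \<in> Gamma M"
  by (simp add: mem_Gamma det_eq)

text \<open>As \<open>\<psi> (- A) = - \<psi> A\<close>, exactly one of \<open>A\<close> and
  \<open>- A\<close> lies in the kernel for each \<open>A\<close> in \<open>G\<close>, so the kernel
  has the same image as \<open>G\<close>.\<close>

lemma kernel_is_congruence_lift:
  assumes G: "subgroup G SL2Z" "- mat 1 \<in> G" and \<psi>: "\<psi> \<in> congruence_chars G" "\<psi> (- mat 1) = -1"
  shows "{A. \<psi> A = 1} \<in> congruence_lifts (to_PSL2Z ` G)"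
proof -
  note D = congruence_charsD[OF \<psi>(1)] and S = subgroup_SL2Z_D[OF G(1)]
  obtain M where M: "M \<ge> 1" "\<forall>A\<in>Gamma M. \<psi> A = 1" using D(4) by blast
  have mem: "A \<in> G" if "\<psi> A = 1" for A using that D(2)[of A] by force
  have one: "\<psi> (mat 1) = 1" using M(2) mat_1_in_Gamma by blast
  have H: "subgroup {A. \<psi> A = 1} SL2Z"
  proof (rule group.subgroupI[OF group_SL2Z])
    show "{A. \<psi> A = 1} \<subseteq> carrier SL2Z" using mem S(1) by auto
    show "{A. \<psi> A = 1} \<noteq> {}" using one by auto
    fix A assume A: "A \<in> {A. \<psi> A = 1}"
    then have AG: "A \<in> G" using mem by auto
    let ?I = "inv\<^bsub>SL2Z\<^esub> A"
    have "?I \<in> G" using subgroup.m_inv_closed[OF G(1) AG] .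
    moreover have "?I ** A = mat 1"
      using group.l_inv[OF group_SL2Z, of A] subgroup.mem_carrier[OF G(1) AG] by simp
    ultimately have "\<psi> ?I * \<psi> A = 1" using D(3)[OF _ AG] one by metis
    then show "?I \<in> {A. \<psi> A = 1}" using A by simp
  next
    fix A B assume "A \<in> {A. \<psi> A = 1}" "B \<in> {A. \<psi> A = 1}"
    then show "A \<otimes>\<^bsub>SL2Z\<^esub> B \<in> {A. \<psi> A = 1}" using D(3) mem by simp
  qed
  have neg: "\<psi> (- A) = - \<psi> A" for A
  proof (cases "A \<in> G")
    case True
    then show ?thesis using D(3)[OF G(2) True] \<psi>(2) minus_mat_1 by simp
  next
    case False
    then have "- A \<notin> G" using S(3)[OF G(2), of "- A"] by (auto simp: minus_mat_1)
    then show ?thesis using False D(2) by simp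
  qed
  have "\<psi> A = 1 \<or> \<psi> (- A) = 1 \<longleftrightarrow> A \<in> G \<or> - A \<in> G" for A
  proof -
    have "A \<in> G \<longleftrightarrow> - A \<in> G"
      using S(3)[OF G(2), of A] S(3)[OF G(2), of "- A"] by (auto simp: minus_mat_1)
    then show ?thesis
      using D(1)[of A] mem[of A] mem[of "- A"] neg[of A] by auto
  qed
  then have "to_PSL2Z ` {A. \<psi> A = 1} = to_PSL2Z ` G"
    unfolding to_PSL2Z_image_eq_iff mem_Collect_eq by blast
  moreover have "Gamma M \<subseteq> {A. \<psi> A = 1}" using M by auto
  ultimately show ?thesis
    using H M(1) unfolding mem_congruence_lifts by (intro conjI exI[of _ M]) simp_all
qed

text \<open>If \<open>- mat 1\<close> is in \<open>H\<close>, then \<open>H\<close> contains both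
  signs of each of its elements and is all of \<open>G\<close>. Otherwise \<open>G\<close> is the
  disjoint union of \<open>H\<close> and its negative, and the character is 1 on the former and -1
  on the latter.\<close>

lemma congruence_lift_cases:
  assumes G: "subgroup G SL2Z" "- mat 1 \<in> G" and H: "H \<in> congruence_lifts (to_PSL2Z ` G)"
  shows "H = G \<or> (\<exists>\<psi>\<in>congruence_chars G. \<psi> (- mat 1) = -1 \<and> H = {A. \<psi> A = 1})"
proof -
  note S = subgroup_SL2Z_D[OF G(1)]
  have H': "subgroup H SL2Z" "to_PSL2Z ` H = to_PSL2Z ` G" "\<exists>M\<ge>1. Gamma M \<subseteq> H"
    using H unfolding mem_congruence_lifts by simp_all
  note SH = subgroup_SL2Z_D[OF H'(1)]
  have "A \<in> G \<longleftrightarrow> - A \<in> G" for A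
    using S(3)[OF G(2), of A] S(3)[OF G(2), of "- A"] by (auto simp: minus_mat_1)
  then have HG: "A \<in> G \<longleftrightarrow> A \<in> H \<or> - A \<in> H" for A
    using H'(2)[unfolded to_PSL2Z_image_eq_iff, rule_format, of A] by simp
  show ?thesis
  proof (cases "- mat 1 \<in> H")
    case True
    have "A \<in> H" if "- A \<in> H" for A
      using SH(3)[OF True that] by (simp add: minus_mat_1)
    then show ?thesis using HG by blast
  next
    case False
    have ex: "\<not> (A \<in> H \<and> - A \<in> H)" for A
    proof
      assume A: "A \<in> H \<and> - A \<in> H"
      then have "inv\<^bsub>SL2Z\<^esub> A \<in> H" "A ** inv\<^bsub>SL2Z\<^esub> A = mat 1"
        using subgroup.m_inv_closed[OF H'(1)] group.r_inv[OF group_SL2Z, of A] SH(1) by auto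
      then show False using A False SH(3)[of "- A" "inv\<^bsub>SL2Z\<^esub> A"] by (simp add: matrix_neg_simps)
    qed
    define \<psi> where "\<psi> A = (if A \<in> H then 1 else if - A \<in> H then -1 else 0 :: int)" for A
    have "\<psi> (A ** B) = \<psi> A * \<psi> B" if "A \<in> G" "B \<in> G" for A B
    proof -
      have "A \<in> H \<or> - A \<in> H" "B \<in> H \<or> - B \<in> H" using that HG by auto
      moreover have "A \<in> H \<Longrightarrow> B \<in> H \<Longrightarrow> A ** B \<in> H" "- A \<in> H \<Longrightarrow> B \<in> H \<Longrightarrow> - (A ** B) \<in> H"
        "A \<in> H \<Longrightarrow> - B \<in> H \<Longrightarrow> - (A ** B) \<in> H" "- A \<in> H \<Longrightarrow> - B \<in> H \<Longrightarrow> A ** B \<in> H"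
        using SH(3)[of A B] SH(3)[of "- A" B] SH(3)[of A "- B"] SH(3)[of "- A" "- B"]
        by (auto simp: matrix_neg_simps)
      ultimately show ?thesis
        using ex[of A] ex[of B] ex[of "A ** B"] unfolding \<psi>_def by auto
    qed
    moreover have "\<exists>M\<ge>1. \<forall>A\<in>Gamma M. \<psi> A = 1"
      using H'(3) unfolding \<psi>_def by auto
    ultimately have "\<psi> \<in> congruence_chars G"
      unfolding congruence_chars_def using HG by (auto simp: \<psi>_def)
    moreover have "\<psi> (- mat 1) = -1" using False SH(2) by (simp add: \<psi>_def)
    moreover have "H = {A. \<psi> A = 1}" by (auto simp: \<psi>_def split: if_splits)
    ultimately show ?thesis by blast
  qed
qed

text \<open>A character is recovered from its kernel because its only other value on
  \<open>G\<close> is -1. The group \<open>G\<close> is no such kernel, as it contains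
  \<open>- mat 1\<close>; this accounts for the summand 1.\<close>

lemma card_congruence_lifts:
  assumes G: "subgroup G SL2Z" "- mat 1 \<in> G" "M \<ge> 1" "Gamma M \<subseteq> G"
    and fin: "finite {\<psi> \<in> congruence_chars G. \<psi> (- mat 1) = -1}"
  shows "card (congruence_lifts (to_PSL2Z ` G)) = 1 + card {\<psi> \<in> congruence_chars G. \<psi> (- mat 1) = -1}"
proof -
  let ?X = "{\<psi> \<in> congruence_chars G. \<psi> (- mat 1) = -1}"
  let ?ker = "\<lambda>\<psi> :: int^2^2 \<Rightarrow> int. {A. \<psi> A = 1}"
  have "G \<in> congruence_lifts (to_PSL2Z ` G)"
    using G unfolding mem_congruence_lifts by (intro conjI exI[of _ M]) simp_all
  then have eq: "congruence_lifts (to_PSL2Z ` G) = insert G (?ker ` ?X)"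
    using kernel_is_congruence_lift[OF G(1,2)] congruence_lift_cases[OF G(1,2)] by blast
  have "inj_on ?ker ?X"
  proof (rule inj_onI)
    fix \<psi> \<theta> assume c: "\<psi> \<in> ?X" "\<theta> \<in> ?X" and eq: "?ker \<psi> = ?ker \<theta>"
    show "\<psi> = \<theta>"
    proof
      fix A
      have iff: "\<psi> A = 1 \<longleftrightarrow> \<theta> A = 1" using eq by blast
      show "\<psi> A = \<theta> A"
        using c iff congruence_charsD(1,2)[of \<psi> G A] congruence_charsD(1,2)[of \<theta> G A]
        by (cases "A \<in> G") auto
    qed
  qed
  then have "card (?ker ` ?X) = card ?X" by (rule card_image)
  moreover have "G \<notin> ?ker ` ?X" using G(2) by auto
  ultimately show ?thesis unfolding eq using fin by simp
qed

text \<open>Take for \<open>k\<close> the product of the primes that divide \<open>M\<close> but not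
  \<open>a\<close>. Then every prime divisor of \<open>M\<close> divides exactly one of
  \<open>a\<close> and \<open>k * m\<close>: if it divides \<open>a\<close>, coprimality keeps it
  from \<open>m\<close>.\<close>

lemma exists_coprime_shift:
  fixes a m M :: int
  assumes "coprime a m" "M \<noteq> 0"
  obtains k where "coprime (a + k * m) M"
proof
  define P where "P = {q \<in> prime_factors M. \<not> q dvd a}"
  have fin: "finite P" unfolding P_def by simp
  show "coprime (a + \<Prod>P * m) M"
  proof (rule ccontr)
    assume "\<not> coprime (a + \<Prod>P * m) M"
    then obtain q where q: "prime q" "q dvd a + \<Prod>P * m" "q dvd M"
      using assms(2) prime_divisor_exists[of "gcd (a + \<Prod>P * m) M"] by (auto simp: coprime_iff_gcd_eq_1)
    show False
    proof (cases "q dvd a")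
      case True
      then have "q dvd \<Prod>P * m" using q(2) by (simp add: dvd_add_right_iff)
      moreover have "\<not> q dvd m"
        using True q(1) assms(1) coprime_common_divisor not_prime_unit by blast
      ultimately have "q dvd \<Prod>P" using q(1) prime_dvd_mult_iff by blast
      then obtain r where "r \<in> P" "q dvd r" using fin q(1) by (auto simp: prime_dvd_prod_iff)
      then have "q = r" using q(1) by (auto simp: P_def intro: primes_dvd_imp_eq)
      then show False using True \<open>r \<in> P\<close> by (simp add: P_def)
    next
      case False
      then have "q \<in> P" using q assms(2) by (simp add: P_def in_prime_factors_iff)
      then have "q dvd \<Prod>P" using fin dvd_prodI[of P q "\<lambda>x. x"] by simp
      then show False using False q(2) by (simp add: dvd_add_left_iff)
    qed
  qed
qed

lemma sign_hom_eq:
  fixes h :: "int \<Rightarrow> int"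
  assumes "\<And>x y. h (x + y) = h x * h y" "\<And>x. h x = 1 \<or> h x = -1"
  shows "h x = (if even x then 1 else h 1)"
proof -
  have sq: "h y * h y = 1" for y using assms(2)[of y] by auto
  show ?thesis
  proof (cases "even x")
    case True
    then obtain y where "x = y + y" by (metis evenE mult_2)
    then show ?thesis using assms(1)[of y y] sq True by simp
  next
    case False
    then obtain y where "x = y + y + 1" by (metis oddE mult_2)
    then show ?thesis using assms(1)[of "y + y" 1] assms(1)[of y y] sq False by simp
  qed
qed

text \<open>For a sign \<open>e\<close> this is the power of \<open>e\<close> with exponent
  \<open>n\<close>, also for negative \<open>n\<close>.\<close>

definition parity_sign :: "int \<Rightarrow> int \<Rightarrow> int" where
  "parity_sign e n = (if even n then 1 else e)"

lemma parity_sign_add: "e * e = 1 \<Longrightarrow> parity_sign e (m + n) = parity_sign e m * parity_sign e n"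
  by (simp add: parity_sign_def)

lemma parity_sign_cong: "(even m \<longleftrightarrow> even n) \<Longrightarrow> parity_sign e m = parity_sign e n"
  by (simp add: parity_sign_def)

lemma congruence_chars_times:
  assumes "\<psi> \<in> congruence_chars G" "\<theta> \<in> congruence_chars G"
  shows "(\<lambda>A. \<psi> A * \<theta> A) \<in> congruence_chars G"
proof -
  note D = congruence_charsD[OF assms(1)] congruence_charsD[OF assms(2)]
  obtain M M' where M: "M \<ge> 1" "\<forall>A\<in>Gamma M. \<psi> A = 1" "M' \<ge> 1" "\<forall>A\<in>Gamma M'. \<theta> A = 1"
    using D(4,8) by blast
  have "Gamma (M * M') \<subseteq> Gamma M" "Gamma (M * M') \<subseteq> Gamma M'"
    by (simp_all add: Gamma_antimono)
  then have "\<exists>K\<ge>1. \<forall>A\<in>Gamma K. \<psi> A * \<theta> A = 1"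
    using M by (intro exI[of _ "M * M'"] conjI ballI) (auto simp: subset_iff)
  moreover have "\<psi> A * \<theta> A = 1 \<or> \<psi> A * \<theta> A = -1" if "A \<in> G" for A
    using D(1,5) that by force
  ultimately show ?thesis
    unfolding congruence_chars_def using D(2,3,6,7) by (simp add: mult.assoc mult.left_commute)
qed

section \<open>Congruence characters of groups given by residue conditions\<close>

locale unit_group =
  fixes R N :: int and U :: "int set"
  assumes R_pos: "R > 0" and N_pos: "N > 0"
    and U_one: "1 \<in> U" and U_neg: "-1 \<in> U"
    and U_mult: "x \<in> U \<Longrightarrow> y \<in> U \<Longrightarrow> x * y \<in> U"
    and U_cong: "x \<in> U \<Longrightarrow> [x = y] (mod R * N) \<Longrightarrow> y \<in> U"
    and U_inv: "x \<in> U \<Longrightarrow> [x * y = 1] (mod R * N) \<Longrightarrow> y \<in> U"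
    and U_coprime: "x \<in> U \<Longrightarrow> coprime x (R * N)"
begin

abbreviation "K \<equiv> R * N"

definition G :: "(int^2^2) set" where
  "G = {A. det A = 1 \<and> R dvd A $ 1 $ 2 \<and> N dvd A $ 2 $ 1 \<and> A $ 1 $ 1 \<in> U}"

definition unit_chars :: "(int \<Rightarrow> int) set" where
  "unit_chars = {f. (\<forall>x\<in>U. f x = 1 \<or> f x = -1) \<and> (\<forall>x. x \<notin> U \<longrightarrow> f x = 0)
     \<and> (\<forall>x\<in>U. \<forall>y\<in>U. f (x * y) = f x * f y) \<and> (\<forall>x\<in>U. \<forall>y. [x = y] (mod K) \<longrightarrow> f x = f y)}"

lemma unit_charsD:
  assumes "f \<in> unit_chars"
  shows "x \<in> U \<Longrightarrow> f x = 1 \<or> f x = -1" "x \<notin> U \<Longrightarrow> f x = 0"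
    "x \<in> U \<Longrightarrow> y \<in> U \<Longrightarrow> f (x * y) = f x * f y" "x \<in> U \<Longrightarrow> [x = y] (mod K) \<Longrightarrow> f x = f y"
    "f 1 = 1"
proof -
  have "f 1 = 1 \<or> f 1 = -1" "f (1 * 1) = f 1 * f 1"
    using assms U_one unfolding unit_chars_def by blast+
  then show "f 1 = 1" by auto
qed (use assms in \<open>unfold unit_chars_def, blast+\<close>)

lemma mem_G: "A \<in> G \<longleftrightarrow> det A = 1 \<and> R dvd A $ 1 $ 2 \<and> N dvd A $ 2 $ 1 \<and> A $ 1 $ 1 \<in> U"
  by (simp add: G_def)

lemma K_dvd: "R dvd x \<Longrightarrow> N dvd y \<Longrightarrow> K dvd x * y" "R dvd x \<Longrightarrow> N dvd y \<Longrightarrow> K dvd y * x"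
  using mult_dvd_mono[of R x N y] by (simp_all add: mult.commute)

lemma G_mult_11: "A \<in> G \<Longrightarrow> B \<in> G \<Longrightarrow> [(A ** B) $ 1 $ 1 = A $ 1 $ 1 * B $ 1 $ 1] (mod K)"
  by (simp add: cong_iff_dvd_diff mem_G K_dvd)

text \<open>\<open>K\<close> divides the product of the off-diagonal entries. So the lower right
  entry inverts the upper left one modulo \<open>K\<close> and lies in \<open>U\<close> by
  \<open>U_inv\<close>, which closes \<open>G\<close> under inverses.\<close>

lemma G_diag: "A \<in> G \<Longrightarrow> [A $ 1 $ 1 * A $ 2 $ 2 = 1] (mod K)"
  using K_dvd(1)[of "A $ 1 $ 2" "A $ 2 $ 1"] by (auto simp: cong_iff_dvd_diff mem_G det_eq algebra_simps)

lemma G_mult: "A \<in> G \<Longrightarrow> B \<in> G \<Longrightarrow> A ** B \<in> G"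
  using U_cong[OF U_mult[of "A $ 1 $ 1" "B $ 1 $ 1"] cong_sym[OF G_mult_11[of A B]]] by (simp add: mem_G det_mul)

lemma subgroup_G: "subgroup G SL2Z"
proof (rule subgroup_SL2Z_I)
  fix A assume A: "A \<in> G"
  then have "A $ 2 $ 2 \<in> U" using U_inv[OF _ G_diag[OF A]] by (simp add: mem_G)
  then show "mat2 (A $ 2 $ 2) (- A $ 1 $ 2) (- A $ 2 $ 1) (A $ 1 $ 1) \<in> G"
    using A by (simp add: mem_G det_eq algebra_simps)
qed (use U_one G_mult in \<open>auto simp: mem_G det_eq\<close>)

lemma minus_one_mem_G: "- mat 1 \<in> G"
  using U_neg by (simp add: mem_G det_eq)

text \<open>The level is \<open>2 * K\<close> rather than \<open>K\<close> so that the parity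
  characters below are trivial on the same subgroup.\<close>

lemma Gamma_subset_G: "Gamma (nat (2 * K)) \<subseteq> G"
proof
  fix A assume A: "A \<in> Gamma (nat (2 * K))"
  have K: "int (nat (2 * K)) = 2 * K" using R_pos N_pos by simp
  then have "[1 = A $ 1 $ 1] (mod K)" "K dvd A $ 1 $ 2" "K dvd A $ 2 $ 1" "det A = 1"
    using A cong_dvd_modulus[of "A $ 1 $ 1" 1 "2 * K" K] unfolding mem_Gamma K
    by (auto simp: cong_0_iff intro: cong_sym dest: dvd_mult_right)
  then show "A \<in> G" unfolding mem_G using U_cong[OF U_one] by (auto dest: dvd_mult_left dvd_mult_right)
qed

section \<open>Reduction to the values at two unipotents\<close>

definition upper :: "int \<Rightarrow> int^2^2" where "upper x = mat2 1 (R * x) 0 1"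
definition lower :: "int \<Rightarrow> int^2^2" where "lower y = mat2 1 0 (N * y) 1"

lemma upper_lower_mem: "upper x \<in> G" "lower x \<in> G"
  using U_one by (simp_all add: upper_def lower_def mem_G det_eq)

lemma upper_add: "upper (x + y) = upper x ** upper y" and lower_add: "lower (x + y) = lower x ** lower y"
  by (auto simp: upper_def lower_def algebra_simps intro!: mat2_eqI)

lemma char_upper:
  assumes "\<psi> \<in> congruence_chars G"
  shows "\<psi> (upper x) = parity_sign (\<psi> (upper 1)) x"
  unfolding parity_sign_def using congruence_charsD(1,3)[OF assms] upper_lower_mem upper_add
  by (intro sign_hom_eq[of "\<lambda>x. \<psi> (upper x)"]) simp_all

lemma char_lower:
  assumes "\<psi> \<in> congruence_chars G"
  shows "\<psi> (lower x) = parity_sign (\<psi> (lower 1)) x"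
  unfolding parity_sign_def using congruence_charsD(1,3)[OF assms] upper_lower_mem lower_add
  by (intro sign_hom_eq[of "\<lambda>x. \<psi> (lower x)"]) simp_all

lemma char_even_level:
  assumes "\<psi> \<in> congruence_chars G"
  obtains M where "M \<ge> 1" "even M" "\<forall>A\<in>Gamma M. \<psi> A = 1"
proof -
  obtain M where M: "M \<ge> 1" "\<forall>A\<in>Gamma M. \<psi> A = 1" using congruence_charsD(4)[OF assms] by blast
  have "Gamma (2 * M) \<subseteq> Gamma M" by (simp add: Gamma_antimono)
  then show ?thesis using M by (intro that[of "2 * M"]) auto
qed

text \<open>Modulo \<open>M\<close> the matrix \<open>lower y ** (A ** upper x)\<close> equals
  \<open>upper 1 ** lower z\<close>, so the two differ by an element of \<open>Gamma M\<close> and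
  \<open>\<psi>\<close> agrees on them. The normalization at \<open>upper 1\<close> removes the
  powers of \<open>upper\<close> and leaves an equation between powers of
  \<open>\<psi> (lower 1)\<close>.\<close>

lemma char_of_coprime:
  assumes \<psi>: "\<psi> \<in> congruence_chars G" and M: "even M" "\<forall>A\<in>Gamma M. \<psi> A = 1"
    and up: "\<psi> (upper 1) = 1"
    and A: "det A = 1" "A $ 1 $ 1 = 1 + K * z" "A $ 1 $ 2 = R * b" "A $ 2 $ 1 = N * c"
    and cop: "coprime (A $ 1 $ 1) (int M)"
  shows "\<psi> A = parity_sign (\<psi> (lower 1)) c"
proof -
  let ?a = "A $ 1 $ 1"
  let ?d = "\<psi> (lower 1)"
  obtain a' where a': "[?a * a' = 1] (mod int M)" using cong_solve_coprime_int[OF cop] by blast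
  \<comment> \<open>Solutions modulo \<open>M\<close> of \<open>a * x + b = 1\<close> and
    \<open>a * y + c = z\<close>, where \<open>a\<close> is the upper left entry: they bring the
    off-diagonal entries to \<open>R\<close> and \<open>N * z\<close>.\<close>
  define x y where "x = a' * (1 - b)" and "y = a' * (z - c)"
  have "[1 = ?a] (mod K)" unfolding A(2) by (simp add: cong_iff_dvd_diff)
  then have AG: "A \<in> G" unfolding mem_G using A U_cong[OF U_one] by simp
  let ?A = "lower y ** (A ** upper x)" and ?B = "upper 1 ** lower z"
  have "det ?A = 1" "det ?B = 1"
    using A(1) by (simp_all add: det_mul) (simp_all add: det_eq upper_def lower_def)
  have e11: "?A $ 1 $ 1 = ?a" "?B $ 1 $ 1 = ?a"
    by (simp_all add: upper_def lower_def A(2))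
  have "[R * (?a * a' * (1 - b) + b) = R * (1 * (1 - b) + b)] (mod int M)"
    by (intro cong_mult cong_add a' cong_refl)
  then have e12: "[?A $ 1 $ 2 = ?B $ 1 $ 2] (mod int M)"
    by (simp add: upper_def lower_def x_def A(3) algebra_simps)
  have "[N * (?a * a' * (z - c) + c) = N * (1 * (z - c) + c)] (mod int M)"
    by (intro cong_mult cong_add a' cong_refl)
  then have e21: "[?A $ 2 $ 1 = ?B $ 2 $ 1] (mod int M)"
    by (simp add: upper_def lower_def y_def A(4) algebra_simps)
  \<comment> \<open>The last entry follows from the determinant, as the upper left entry is
    invertible modulo \<open>M\<close>.\<close>
  have "?a * ?A $ 2 $ 2 = 1 + ?A $ 1 $ 2 * ?A $ 2 $ 1" "?a * ?B $ 2 $ 2 = 1 + ?B $ 1 $ 2 * ?B $ 2 $ 1"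
    using \<open>det ?A = 1\<close> \<open>det ?B = 1\<close> unfolding det_eq e11 by simp_all
  then have "[?a * ?A $ 2 $ 2 = ?a * ?B $ 2 $ 2] (mod int M)"
    using cong_add[OF cong_refl cong_mult[OF e12 e21]] by metis
  then have "[?A $ 2 $ 2 = ?B $ 2 $ 2] (mod int M)"
    using cop cong_mult_lcancel by blast
  then have "\<forall>i j. [?A $ i $ j = ?B $ i $ j] (mod int M)"
    unfolding forall_2 using e11 e12 e21 by simp
  then obtain X where X: "X \<in> Gamma M" "?A = X ** ?B"
    using Gamma_quotient[OF \<open>det ?A = 1\<close> \<open>det ?B = 1\<close>] by blast
  have \<psi>X: "\<psi> X = 1" using X M by blast
  \<comment> \<open>Outside \<open>G\<close> the value would be 0.\<close>
  then have XG: "X \<in> G" using congruence_charsD(2)[OF \<psi>, of X] by force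
  have eq: "parity_sign ?d y * \<psi> A = parity_sign ?d z"
    using arg_cong[OF X(2), of \<psi>] \<psi>X XG AG up
    by (simp add: congruence_charsD(3)[OF \<psi>] G_mult upper_lower_mem char_upper[OF \<psi>, of x]
        char_lower[OF \<psi>, of y] char_lower[OF \<psi>, of z] parity_sign_def)
  \<comment> \<open>\<open>M\<close> is even, so \<open>a'\<close> is odd and \<open>y\<close> has
    the parity of \<open>z - c\<close>.\<close>
  have "[?a * a' = 1] (mod 2)" by (rule cong_dvd_modulus[OF a']) (use M in simp)
  then have "odd (?a * a')" unfolding odd_iff_mod_2_eq_one cong_def by simp
  then have "odd a'" by simp
  then show ?thesis
    using eq congruence_charsD(1)[OF \<psi> upper_lower_mem(2), of 1]
    unfolding y_def parity_sign_def by (auto split: if_splits)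
qed

lemma G1_params:
  assumes "A \<in> G" "[A $ 1 $ 1 = 1] (mod K)"
  obtains z b c where "A $ 1 $ 1 = 1 + K * z" "A $ 1 $ 2 = R * b" "A $ 2 $ 1 = N * c"
proof -
  have "K dvd A $ 1 $ 1 - 1" using assms(2) by (simp add: cong_iff_dvd_diff)
  then obtain z where "A $ 1 $ 1 - 1 = K * z" by (rule dvdE)
  moreover obtain b c where "A $ 1 $ 2 = R * b" "A $ 2 $ 1 = N * c"
    using assms(1) unfolding mem_G dvd_def by blast
  ultimately show ?thesis by (intro that[of z b c]) simp_all
qed

text \<open>The upper left entry is coprime to \<open>A $ 2 $ 1\<close> by the determinant and to
  \<open>R\<close> by membership in \<open>U\<close>. Hence some \<open>upper k ** A\<close> has
  upper left entry coprime to the level, where \<open>char_of_coprime\<close> applies.\<close>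

lemma char_trivial:
  assumes \<psi>: "\<psi> \<in> congruence_chars G" and ul: "\<psi> (upper 1) = 1" "\<psi> (lower 1) = 1"
    and A: "A \<in> G" "[A $ 1 $ 1 = 1] (mod K)"
  shows "\<psi> A = 1"
proof -
  obtain M where M: "M \<ge> 1" "even M" "\<forall>A\<in>Gamma M. \<psi> A = 1" using char_even_level[OF \<psi>] .
  obtain z b c where p: "A $ 1 $ 1 = 1 + K * z" "A $ 1 $ 2 = R * b" "A $ 2 $ 1 = N * c"
    using G1_params[OF A] .
  have det: "det A = 1" using A(1) by (simp add: mem_G)
  have "A $ 1 $ 1 * A $ 2 $ 2 - A $ 1 $ 2 * A $ 2 $ 1 = 1" using det by (simp add: det_eq)
  then have "coprime (A $ 1 $ 1) (A $ 2 $ 1)"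
    by (intro coprimeI) (metis dvd_diff dvd_mult dvd_mult2)
  moreover have "coprime (A $ 1 $ 1) R"
    using U_coprime A(1) by (simp add: mem_G)
  ultimately have "coprime (A $ 1 $ 1) (R * A $ 2 $ 1)" by simp
  then obtain k where k: "coprime (A $ 1 $ 1 + k * (R * A $ 2 $ 1)) (int M)"
    using exists_coprime_shift[of "A $ 1 $ 1" "R * A $ 2 $ 1" "int M"] M(1) by auto
  let ?A = "upper k ** A"
  have "\<psi> ?A = parity_sign (\<psi> (lower 1)) c"
  proof (rule char_of_coprime[OF \<psi> M(2,3) ul(1), where z = "z + k * c" and b = "b + k * A $ 2 $ 2"])
    show "det ?A = 1" using det by (simp add: det_mul) (simp add: det_eq upper_def)
    show "coprime (?A $ 1 $ 1) (int M)" using k by (simp add: upper_def algebra_simps)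
  qed (simp_all add: upper_def p algebra_simps)
  then show ?thesis
    using congruence_charsD(3)[OF \<psi> upper_lower_mem(1) A(1), of k] char_upper[OF \<psi>, of k] ul
    by (simp add: parity_sign_def)
qed

text \<open>\<open>upper k ** A\<close> and \<open>A ** lower l\<close> both fall under \<open>char_of_coprime\<close>; comparing them forces
  \<open>\<psi> (lower 1) ^ 2 = \<psi> (lower 1)\<close>.\<close>

lemma char_odd_level:
  assumes \<psi>: "\<psi> \<in> congruence_chars G" and up: "\<psi> (upper 1) = 1" and K: "odd K"
  shows "\<psi> (lower 1) = 1"
proof -
  let ?d = "\<psi> (lower 1)"
  obtain M where M: "M \<ge> 1" "even M" "\<forall>A\<in>Gamma M. \<psi> A = 1" using char_even_level[OF \<psi>] .
  \<comment> \<open>The factor \<open>K + 2\<close> makes the determinant 1. For odd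
    \<open>K\<close> it is odd while \<open>1 + K\<close> is even, so right multiplication by
    \<open>lower l\<close> leaves the parity of the lower left factor unchanged, although
    \<open>l\<close> is odd.\<close>
  define A where "A = mat2 (1 + K) R (N * (K + 2)) (1 + K)"
  have det: "det A = 1" by (simp add: A_def det_eq algebra_simps)
  have "[1 = 1 + K] (mod K)" by (simp add: cong_iff_dvd_diff)
  then have AG: "A \<in> G" using det U_cong[OF U_one] by (simp add: mem_G A_def)
  have "coprime (1 + K) K" "coprime (1 + K) (1 + K + 1)"
    by (simp_all only: coprime_add_one_left coprime_add_one_right add.commute[of 1])
  then have "coprime (1 + K) (K * (K + 2))" by (simp add: add.commute)
  then obtain k where k: "coprime (1 + K + k * (K * (K + 2))) (int M)"
    using exists_coprime_shift[of "1 + K" "K * (K + 2)" "int M"] M(1) by auto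
  have "\<psi> (upper k ** A) = parity_sign ?d (K + 2)"
  proof (rule char_of_coprime[OF \<psi> M(2,3) up, where z = "1 + k * (K + 2)" and b = "1 + k * (1 + K)"])
    show "det (upper k ** A) = 1" using det by (simp add: det_mul) (simp add: det_eq upper_def)
    show "coprime ((upper k ** A) $ 1 $ 1) (int M)" using k by (simp add: A_def upper_def algebra_simps)
  qed (simp_all add: upper_def A_def algebra_simps)
  then have 1: "\<psi> A = ?d"
    using congruence_charsD(3)[OF \<psi> upper_lower_mem(1) AG, of k] char_upper[OF \<psi>, of k] up K
    by (simp add: parity_sign_def)
  obtain l where l: "coprime (1 + K + l * K) (int M)"
    using exists_coprime_shift[of "1 + K" K "int M"] \<open>coprime (1 + K) K\<close> M(1) by auto
  have "coprime (1 + K + l * K) 2"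
    by (rule coprime_divisors[OF dvd_refl _ l]) (use M in simp)
  \<comment> \<open>A number coprime to the even level is odd; as \<open>1 + K\<close> is even,
    \<open>l * K\<close> must be odd.\<close>
  then have "odd l" using K by simp
  have "\<psi> (A ** lower l) = parity_sign ?d (K + 2 + (1 + K) * l)"
  proof (rule char_of_coprime[OF \<psi> M(2,3) up, where z = "1 + l" and b = 1])
    show "det (A ** lower l) = 1" using det by (simp add: det_mul) (simp add: det_eq lower_def)
    show "coprime ((A ** lower l) $ 1 $ 1) (int M)" using l by (simp add: A_def lower_def algebra_simps)
  qed (simp_all add: lower_def A_def algebra_simps)
  then have "?d * ?d = ?d"
    using congruence_charsD(3)[OF \<psi> AG upper_lower_mem(2), of l] char_lower[OF \<psi>, of l] 1 K \<open>odd l\<close>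
    by (simp add: parity_sign_def)
  then show ?thesis
    using congruence_charsD(1)[OF \<psi> upper_lower_mem(2), of 1] by auto
qed

text \<open>For odd \<open>K\<close> the parity is that of the permutation induced on the three nonzero vectors modulo 2.\<close>

definition parity_char :: "int \<Rightarrow> int \<Rightarrow> int^2^2 \<Rightarrow> int" where
  "parity_char e d A = (if even K then parity_sign e (A $ 1 $ 2 div R) * parity_sign d (A $ 2 $ 1 div N)
     else parity_sign e (A $ 1 $ 2 + A $ 2 $ 1 + (1 + A $ 1 $ 1) * (1 + A $ 2 $ 2)))"

definition signs :: "(int \<times> int) set" where
  "signs = {(e, d). (e = 1 \<or> e = -1) \<and> (d = 1 \<or> d = -1) \<and> (odd K \<longrightarrow> e = d)}"

lemma card_signs: "card signs = (if odd K then 2 else 4)"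
proof -
  have "signs = (if odd K then {(1, 1), (-1, -1)} else {1, -1} \<times> {1, -1})"
    by (auto simp: signs_def)
  then show ?thesis by simp
qed

lemma finite_signs: "finite signs"
  using card_signs by (intro card_ge_0_finite) (simp split: if_splits)

lemma parity_char_mult:
  assumes "(e, d) \<in> signs" "A \<in> G" "B \<in> G"
  shows "parity_char e d (A ** B) = parity_char e d A * parity_char e d B"
proof -
  have sq: "e * e = 1" "d * d = 1" using assms(1) by (auto simp: signs_def)
  show ?thesis
  proof (cases "even K")
    case True
    have odd: "odd (X $ 1 $ 1)" "odd (X $ 2 $ 2)" if "X \<in> G" for X
    proof -
      have "[X $ 1 $ 1 * X $ 2 $ 2 = 1] (mod 2)"
        using G_diag[OF that] True by (rule cong_dvd_modulus)
      then have "odd (X $ 1 $ 1 * X $ 2 $ 2)" unfolding odd_iff_mod_2_eq_one cong_def by simp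
      then show "odd (X $ 1 $ 1)" "odd (X $ 2 $ 2)" by simp_all
    qed
    obtain b c b' c' where p: "A $ 1 $ 2 = R * b" "A $ 2 $ 1 = N * c" "B $ 1 $ 2 = R * b'" "B $ 2 $ 1 = N * c'"
      using assms(2,3) unfolding mem_G dvd_def by blast
    have "(A ** B) $ 1 $ 2 = R * (A $ 1 $ 1 * b' + b * B $ 2 $ 2)"
      "(A ** B) $ 2 $ 1 = N * (c * B $ 1 $ 1 + A $ 2 $ 2 * c')"
      by (simp_all add: p algebra_simps)
    \<comment> \<open>For even \<open>K\<close> the diagonal entries are odd, so they drop out of
      both cofactors modulo 2.\<close>
    then have "parity_char e d (A ** B) = parity_sign e (b + b') * parity_sign d (c + c')"
      using True R_pos N_pos odd[OF assms(2)] odd[OF assms(3)]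
      unfolding parity_char_def by (simp add: parity_sign_def)
    also have "\<dots> = parity_char e d A * parity_char e d B"
      using True R_pos N_pos by (simp add: p parity_char_def parity_sign_add sq)
    finally show ?thesis .
  next
    case False
    \<comment> \<open>Modulo 2, \<open>?q\<close> is 0 at the identity and at the two elements of
      order 3, and 1 at the three involutions. Its additivity is a Boolean identity in the parities
      of the eight entries, subject to both determinants being odd.\<close>
    let ?q = "\<lambda>X :: int^2^2. X $ 1 $ 2 + X $ 2 $ 1 + (1 + X $ 1 $ 1) * (1 + X $ 2 $ 2)"
    have det: "odd (X $ 1 $ 1 * X $ 2 $ 2 - X $ 1 $ 2 * X $ 2 $ 1)" if "X \<in> G" for X
      using that by (simp add: mem_G det_eq)
    have odd1: "even (1 :: int) \<longleftrightarrow> False" by simp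
    have "even (?q (A ** B)) \<longleftrightarrow> even (?q A + ?q B)"
      using det[OF assms(2)] det[OF assms(3)]
      unfolding mult_nth even_add even_mult_iff even_diff odd1 by argo
    then have "parity_sign e (?q (A ** B)) = parity_sign e (?q A + ?q B)"
      by (rule parity_sign_cong)
    then show ?thesis using False unfolding parity_char_def by (simp only: parity_sign_add sq if_False)
  qed
qed

lemma parity_char_values:
  assumes "(e, d) \<in> signs"
  shows "parity_char e d A = 1 \<or> parity_char e d A = -1"
    and "parity_char e d (upper 1) = e" "parity_char e d (lower 1) = d"
    and "parity_char e d (- mat 1) = 1"
    and "A \<in> Gamma (nat (2 * K)) \<Longrightarrow> parity_char e d A = 1"
proof -
  show "parity_char e d A = 1 \<or> parity_char e d A = -1"
    using assms by (auto simp: signs_def parity_char_def parity_sign_def)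
  show "parity_char e d (upper 1) = e" "parity_char e d (lower 1) = d"
    using assms R_pos N_pos
    by (auto simp: signs_def parity_char_def parity_sign_def upper_def lower_def)
  show "parity_char e d (- mat 1) = 1"
    by (simp add: parity_char_def parity_sign_def)
  assume A: "A \<in> Gamma (nat (2 * K))"
  have K: "int (nat (2 * K)) = 2 * K" using R_pos N_pos by simp
  have dvd: "2 * K dvd A $ 1 $ 2" "2 * K dvd A $ 2 $ 1" "2 * K dvd A $ 1 $ 1 - 1" "2 * K dvd A $ 2 $ 2 - 1"
    using A unfolding mem_Gamma K by (simp_all add: cong_0_iff cong_iff_dvd_diff)
  then obtain b c where bc: "A $ 1 $ 2 = 2 * K * b" "A $ 2 $ 1 = 2 * K * c"
    unfolding dvd_def by blast
  have "even (A $ 1 $ 1 - 1)" "even (A $ 2 $ 2 - 1)" using dvd(3,4) by (metis dvd_mult_left)+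
  moreover have "A $ 1 $ 2 div R = 2 * (N * b)" "A $ 2 $ 1 div N = 2 * (R * c)"
    using R_pos N_pos by (simp_all add: bc mult.assoc mult.left_commute)
  ultimately show "parity_char e d A = 1"
    by (simp add: parity_char_def parity_sign_def bc)
qed

section \<open>Classification of the congruence characters of \<open>G\<close>\<close>

definition assemble :: "(int \<Rightarrow> int) \<times> int \<times> int \<Rightarrow> int^2^2 \<Rightarrow> int" where
  "assemble = (\<lambda>(f, e, d) A. if A \<in> G then f (A $ 1 $ 1) * parity_char e d A else 0)"

lemma assemble_mem:
  assumes "f \<in> unit_chars" "(e, d) \<in> signs"
  shows "assemble (f, e, d) \<in> congruence_chars G"
proof -
  note f = unit_charsD[OF assms(1)] and p = parity_char_values[OF assms(2)]
  have U: "A $ 1 $ 1 \<in> U" if "A \<in> G" for A using that by (simp add: mem_G)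
  have "f (A $ 1 $ 1) * parity_char e d A = 1 \<or> f (A $ 1 $ 1) * parity_char e d A = -1" if "A \<in> G" for A
    using f(1)[OF U[OF that]] p(1)[of A] by auto
  moreover have "f ((A ** B) $ 1 $ 1) = f (A $ 1 $ 1) * f (B $ 1 $ 1)" if "A \<in> G" "B \<in> G" for A B
    using f(3)[OF U[OF that(1)] U[OF that(2)]]
      f(4)[OF U_mult[OF U[OF that(1)] U[OF that(2)]] cong_sym[OF G_mult_11[OF that]]] by simp
  moreover have "f (A $ 1 $ 1) = 1" if "A \<in> Gamma (nat (2 * K))" for A
  proof -
    have "[A $ 1 $ 1 = 1] (mod 2 * K)" using that R_pos N_pos by (simp add: mem_Gamma)
    then have "[1 = A $ 1 $ 1] (mod K)" using cong_dvd_modulus cong_sym dvd_triv_right by metis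
    then show ?thesis using f(4)[OF U_one] f(5) by simp
  qed
  moreover have "nat (2 * K) \<ge> 1" using mult_pos_pos[OF R_pos N_pos] by linarith
  ultimately show ?thesis
    unfolding congruence_chars_def assemble_def
    using parity_char_mult[OF assms(2)] p(5) Gamma_subset_G
    by (auto simp: G_mult intro!: exI[of _ "nat (2 * K)"])
qed

lemma trivial_unit_char: "(\<lambda>x. if x \<in> U then 1 else 0) \<in> unit_chars"
  unfolding unit_chars_def using U_mult U_cong by auto

lemma ex_mem_G: "u \<in> U \<Longrightarrow> \<exists>A\<in>G. A $ 1 $ 1 = u"
proof -
  assume u: "u \<in> U"
  obtain v where "[u * v = 1] (mod K)" using cong_solve_coprime_int[OF U_coprime[OF u]] by blast
  then obtain k where "u * v - 1 = K * k" unfolding cong_iff_dvd_diff by (rule dvdE)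
  then have "mat2 u R (N * k) v \<in> G" using u by (simp add: mem_G det_eq algebra_simps)
  then show ?thesis by (intro bexI[of _ "mat2 u R (N * k) v"]) simp
qed

text \<open>The quotient of \<open>A\<close> by \<open>B\<close> has upper left entry 1 modulo
  \<open>K\<close>, and there a normalized character is trivial.\<close>

lemma char_eq_if_cong:
  assumes \<psi>: "\<psi> \<in> congruence_chars G" "\<psi> (upper 1) = 1" "\<psi> (lower 1) = 1"
    and AB: "A \<in> G" "B \<in> G" "[A $ 1 $ 1 = B $ 1 $ 1] (mod K)"
  shows "\<psi> A = \<psi> B"
proof -
  define B' where "B' = mat2 (B $ 2 $ 2) (- B $ 1 $ 2) (- B $ 2 $ 1) (B $ 1 $ 1)"
  have "B $ 2 $ 2 \<in> U" using AB(2) U_inv[OF _ G_diag[OF AB(2)]] by (simp add: mem_G)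
  then have B': "B' \<in> G" "B' ** B = mat 1"
    using AB(2) by (auto simp: B'_def mem_G det_eq algebra_simps intro!: mat2_eqI)
  have "[(A ** B') $ 1 $ 1 = A $ 1 $ 1 * B' $ 1 $ 1] (mod K)" by (rule G_mult_11[OF AB(1) B'(1)])
  also have "[A $ 1 $ 1 * B' $ 1 $ 1 = B $ 1 $ 1 * B' $ 1 $ 1] (mod K)"
    by (rule cong_mult[OF AB(3) cong_refl])
  also have "[B $ 1 $ 1 * B' $ 1 $ 1 = 1] (mod K)" using G_diag[OF AB(2)] by (simp add: B'_def)
  finally have "\<psi> (A ** B') = 1" using char_trivial[OF \<psi> G_mult[OF AB(1) B'(1)]] by simp
  moreover have "A = (A ** B') ** B" by (simp add: B'(2) flip: matrix_mul_assoc)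
  ultimately show ?thesis
    using congruence_charsD(3)[OF \<psi>(1) G_mult[OF AB(1) B'(1)] AB(2)] by simp
qed

text \<open>\<open>\<psi>\<close> depends only on the upper left entry modulo \<open>K\<close>, and
  every element of \<open>U\<close> occurs as such an entry, so any choice of matrices
  \<open>w u\<close> yields the same \<open>f\<close>.\<close>

lemma normalized_char:
  assumes \<psi>: "\<psi> \<in> congruence_chars G" "\<psi> (upper 1) = 1" "\<psi> (lower 1) = 1"
  obtains f where "f \<in> unit_chars" "\<And>A. A \<in> G \<Longrightarrow> \<psi> A = f (A $ 1 $ 1)"
proof -
  define w where "w u = (SOME A. A \<in> G \<and> A $ 1 $ 1 = u)" for u
  have w: "w u \<in> G" "w u $ 1 $ 1 = u" if "u \<in> U" for u
    using someI_ex[of "\<lambda>A. A \<in> G \<and> A $ 1 $ 1 = u"] ex_mem_G[OF that] unfolding w_def by blast+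
  define f where "f u = (if u \<in> U then \<psi> (w u) else 0)" for u
  have f: "\<psi> A = f (A $ 1 $ 1)" if "A \<in> G" for A
  proof -
    have "A $ 1 $ 1 \<in> U" using that by (simp add: mem_G)
    then show ?thesis using char_eq_if_cong[OF \<psi> that w(1)] w(2) by (simp add: f_def)
  qed
  have "f (x * y) = f x * f y" if "x \<in> U" "y \<in> U" for x y
  proof -
    have "[w (x * y) $ 1 $ 1 = (w x ** w y) $ 1 $ 1] (mod K)"
      using G_mult_11[OF w(1)[OF that(1)] w(1)[OF that(2)]] w(2) that U_mult
      by (simp add: cong_sym)
    then have "\<psi> (w (x * y)) = \<psi> (w x ** w y)"
      by (intro char_eq_if_cong[OF \<psi>] w G_mult U_mult that)
    then show ?thesis
      using congruence_charsD(3)[OF \<psi>(1)] w that U_mult by (simp add: f_def)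
  qed
  moreover have "f x = f y" if "x \<in> U" "[x = y] (mod K)" for x y
    using char_eq_if_cong[OF \<psi> w(1) w(1), of x y] w(2) that U_cong[OF that] by (simp add: f_def)
  ultimately have "f \<in> unit_chars"
    unfolding unit_chars_def using congruence_charsD(1)[OF \<psi>(1)] w(1) by (auto simp: f_def)
  then show ?thesis using f that by blast
qed

text \<open>\<open>char_odd_level\<close> asks for the value 1 at \<open>upper 1\<close>. For odd
  \<open>K\<close> the twist by the parity character with both signs equal to
  \<open>\<psi> (upper 1)\<close> achieves this, and the product of the two signs then comes out as
  1.\<close>

lemma signs_of_char:
  assumes "\<psi> \<in> congruence_chars G"
  shows "(\<psi> (upper 1), \<psi> (lower 1)) \<in> signs"
proof -
  let ?e = "\<psi> (upper 1)" and ?d = "\<psi> (lower 1)"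
  have v: "?e = 1 \<or> ?e = -1" "?d = 1 \<or> ?d = -1"
    using congruence_charsD(1)[OF assms] upper_lower_mem by blast+
  have "?e = ?d" if K: "odd K"
  proof -
    have s: "(?e, ?e) \<in> signs" using v by (simp add: signs_def)
    let ?\<theta> = "assemble (\<lambda>x. if x \<in> U then 1 else 0, ?e, ?e)"
    have \<theta>: "?\<theta> \<in> congruence_chars G" by (rule assemble_mem[OF trivial_unit_char s])
    have val: "?\<theta> (upper 1) = ?e" "?\<theta> (lower 1) = ?e"
      using parity_char_values(2,3)[OF s] upper_lower_mem U_one
      by (simp_all add: assemble_def) (simp_all add: upper_def lower_def)
    have "?d * ?e = 1"
      using char_odd_level[OF congruence_chars_times[OF assms \<theta>] _ K] v(1) val by auto
    then show ?thesis using v by auto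
  qed
  then show ?thesis using v by (simp add: signs_def)
qed

lemma bij_betw_assemble: "bij_betw assemble (unit_chars \<times> signs) (congruence_chars G)"
proof (rule bij_betw_imageI)
  have val: "assemble (f, e, d) (upper 1) = e" "assemble (f, e, d) (lower 1) = d"
    if "f \<in> unit_chars" "(e, d) \<in> signs" for f e d
    using parity_char_values(2,3)[OF that(2)] upper_lower_mem unit_charsD(5)[OF that(1)]
    by (simp_all add: assemble_def) (simp_all add: upper_def lower_def)
  show "inj_on assemble (unit_chars \<times> signs)"
  proof (rule inj_onI)
    fix v w assume v: "v \<in> unit_chars \<times> signs" and w: "w \<in> unit_chars \<times> signs"
      and vw: "assemble v = assemble w"
    obtain f e d f' e' d' where t: "v = (f, e, d)" "w = (f', e', d')" by (cases v, cases w)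
    have f: "f \<in> unit_chars" "f' \<in> unit_chars" and s: "(e, d) \<in> signs" "(e', d') \<in> signs"
      and eq: "assemble (f, e, d) = assemble (f', e', d')"
      using v w vw by (simp_all add: t)
    have ed: "e = e'" "d = d'" using val[OF f(1) s(1)] val[OF f(2) s(2)] eq by simp_all
    have "f u = f' u" for u
    proof (cases "u \<in> U")
      case True
      then obtain A where A: "A \<in> G" "A $ 1 $ 1 = u" using ex_mem_G by blast
      then show ?thesis
        using fun_cong[OF eq, of A] parity_char_values(1)[OF s(1), of A] ed by (auto simp: assemble_def)
    next
      case False
      then show ?thesis using unit_charsD(2)[OF f(1)] unit_charsD(2)[OF f(2)] by simp
    qed
    then have "f = f'" by (rule ext)
    then show "v = w" using ed by (simp add: t)
  qed
  show "assemble ` (unit_chars \<times> signs) = congruence_chars G"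
  proof
    show "assemble ` (unit_chars \<times> signs) \<subseteq> congruence_chars G"
      using assemble_mem by auto
    show "congruence_chars G \<subseteq> assemble ` (unit_chars \<times> signs)"
    proof
      fix \<psi> assume \<psi>: "\<psi> \<in> congruence_chars G"
      let ?e = "\<psi> (upper 1)" and ?d = "\<psi> (lower 1)"
      note s = signs_of_char[OF \<psi>]
      have sq: "?e * ?e = 1" "?d * ?d = 1" using s by (auto simp: signs_def)
      \<comment> \<open>The parity character with the same values at the two unipotents; multiplying
        by it makes both values 1, which leaves a function of the upper left entry.\<close>
      let ?\<theta> = "assemble (\<lambda>x. if x \<in> U then 1 else 0, ?e, ?d)"
      have \<theta>: "(\<lambda>A. \<psi> A * ?\<theta> A) \<in> congruence_chars G"
        by (rule congruence_chars_times[OF \<psi> assemble_mem[OF trivial_unit_char s]])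
      obtain f where f: "f \<in> unit_chars" "\<And>A. A \<in> G \<Longrightarrow> \<psi> A * ?\<theta> A = f (A $ 1 $ 1)"
        using normalized_char[OF \<theta>] val[OF trivial_unit_char s] sq by auto
      have "\<psi> A = assemble (f, ?e, ?d) A" for A
      proof (cases "A \<in> G")
        case True
        then have "f (A $ 1 $ 1) = \<psi> A * parity_char ?e ?d A"
          using f(2)[OF True] by (simp add: assemble_def mem_G)
        then show ?thesis
          using True parity_char_values(1)[OF s, of A] by (auto simp: assemble_def)
      next
        case False
        then show ?thesis using congruence_charsD(2)[OF \<psi>] by (simp add: assemble_def)
      qed
      then have "\<psi> = assemble (f, ?e, ?d)" by (rule ext)
      then show "\<psi> \<in> assemble ` (unit_chars \<times> signs)"
        using f(1) s by (intro image_eqI[of _ _ "(f, ?e, ?d)"]) simp_all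
    qed
  qed
qed

lemma card_lifts_G:
  assumes "finite {f \<in> unit_chars. f (-1) = -1}"
  shows "card (congruence_lifts (to_PSL2Z ` G))
    = 1 + card {f \<in> unit_chars. f (-1) = -1} * (if odd K then 2 else 4)"
proof -
  let ?O = "{f \<in> unit_chars. f (-1) = -1}"
  have val: "assemble (f, e, d) (- mat 1) = f (-1)" if "(e, d) \<in> signs" for f e d
    using parity_char_values(4)[OF that] minus_one_mem_G by (simp add: assemble_def)
  have "assemble ` (?O \<times> signs) = {\<psi> \<in> congruence_chars G. \<psi> (- mat 1) = -1}"
  proof
    show "assemble ` (?O \<times> signs) \<subseteq> {\<psi> \<in> congruence_chars G. \<psi> (- mat 1) = -1}"
      using assemble_mem val by auto
    show "{\<psi> \<in> congruence_chars G. \<psi> (- mat 1) = -1} \<subseteq> assemble ` (?O \<times> signs)"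
    proof
      fix \<psi> assume \<psi>: "\<psi> \<in> {\<psi> \<in> congruence_chars G. \<psi> (- mat 1) = -1}"
      then have "\<psi> \<in> assemble ` (unit_chars \<times> signs)"
        using bij_betw_imp_surj_on[OF bij_betw_assemble] by simp
      then obtain f e d where "f \<in> unit_chars" "(e, d) \<in> signs" "\<psi> = assemble (f, e, d)"
        by auto
      then show "\<psi> \<in> assemble ` (?O \<times> signs)" using \<psi> val by (intro image_eqI) auto
    qed
  qed
  moreover have "inj_on assemble (?O \<times> signs)"
    using bij_betw_imp_inj_on[OF bij_betw_assemble] by (rule inj_on_subset) auto
  ultimately have b: "bij_betw assemble (?O \<times> signs) {\<psi> \<in> congruence_chars G. \<psi> (- mat 1) = -1}"
    by (simp add: bij_betw_def)
  have "finite {\<psi> \<in> congruence_chars G. \<psi> (- mat 1) = -1}"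
    using bij_betw_finite[OF b] assms finite_signs by simp
  moreover have "nat (2 * K) \<ge> 1" using mult_pos_pos[OF R_pos N_pos] by linarith
  ultimately show ?thesis
    using card_congruence_lifts[OF subgroup_G minus_one_mem_G _ Gamma_subset_G]
      bij_betw_same_card[OF b] card_signs by (simp add: card_cartesian_product)
qed

end

section \<open>The groups \<open>Gamma0\<close>, \<open>Gamma1\<close> and \<open>Gamma\<close>\<close>

lemma unit_group_coprime:
  assumes "N > 0" shows "unit_group 1 N {x. coprime x N}"
proof
  fix x y :: int
  assume "x \<in> {x. coprime x N}" "[x * y = 1] (mod 1 * N)"
  then show "y \<in> {x. coprime x N}"
    using cong_imp_coprime[OF cong_sym, of "x * y" 1 N] by simp
qed (use assms in \<open>auto dest: cong_imp_coprime\<close>)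

lemma card_lifts_Gamma0:
  assumes "N \<ge> 1" "finite (real_chars (int N))"
  shows "card (congruence_lifts (to_PSL2Z ` Gamma0 N))
    = 1 + card {f \<in> real_chars (int N). f (-1) = -1} * (if odd N then 2 else 4)"
proof -
  interpret unit_group 1 "int N" "{x. coprime x (int N)}"
    using assms(1) by (intro unit_group_coprime) simp
  have "coprime (A $ 1 $ 1) (int N)" if "det A = 1" "int N dvd A $ 2 $ 1" for A :: "int^2^2"
  proof (rule coprimeI)
    fix q assume q: "q dvd A $ 1 $ 1" "q dvd int N"
    then have "q dvd A $ 2 $ 1" using that(2) dvd_trans by blast
    then show "is_unit q" using q(1) that(1) by (metis det_eq dvd_diff dvd_mult dvd_mult2)
  qed
  then have "Gamma0 N = G"
    by (auto simp: Gamma0_def mem_G cong_0_iff)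
  moreover have "unit_chars = real_chars (int N)"
  proof (intro equalityI subsetI)
    fix f assume f: "f \<in> real_chars (int N)"
    then show "f \<in> unit_chars" unfolding unit_chars_def using real_charsD[OF f] by simp
  next
    fix f assume f: "f \<in> unit_chars"
    note D = unit_charsD[OF f, unfolded mem_Collect_eq]
    \<comment> \<open>A product is a unit exactly when both factors are, so multiplicativity
      persists at non-units, where the values are 0.\<close>
    have "f (x * y) = f x * f y" for x y
      using D(2)[of x] D(2)[of y] D(2)[of "x * y"] D(3)[of x y]
      by (cases "coprime x (int N)"; cases "coprime y (int N)") simp_all
    moreover have "f x = f y" if "[x = y] (mod int N)" for x y
    proof (cases "coprime x (int N)")
      case True
      then show ?thesis using D(4)[of x y] that by simp
    next
      case False
      then have "\<not> coprime y (int N)" using that cong_imp_coprime cong_sym by blast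
      then show ?thesis using False D(2) by simp
    qed
    ultimately show "f \<in> real_chars (int N)"
      unfolding real_chars_def using D(1,2) by blast
  qed
  ultimately show ?thesis using card_lifts_G assms(2) by simp
qed

section \<open>The groups generated by -1 and \<open>Gamma1\<close> or \<open>Gamma\<close>\<close>

abbreviation pm_units :: "int \<Rightarrow> int set" where
  "pm_units n \<equiv> {x. [x = 1] (mod n) \<or> [x = -1] (mod n)}"

lemma pm_units_iff: "x \<in> pm_units n \<longleftrightarrow> (\<exists>u. x = 1 + n * u \<or> x = - (1 + n * u))"
proof -
  have "[x = 1] (mod n) \<longleftrightarrow> (\<exists>u. x = 1 + n * u)"
    by (metis cong_iff_lin cong_sym_eq)
  moreover have "[x = -1] (mod n) \<longleftrightarrow> (\<exists>u. x = - (1 + n * u))"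
  proof
    assume "[x = -1] (mod n)"
    then obtain k where "x - -1 = n * k" unfolding cong_iff_dvd_diff by (rule dvdE)
    then show "\<exists>u. x = - (1 + n * u)" by (intro exI[of _ "- k"]) simp
  next
    assume "\<exists>u. x = - (1 + n * u)"
    then show "[x = -1] (mod n)" by (auto simp: cong_iff_dvd_diff)
  qed
  ultimately show ?thesis by auto
qed

text \<open>\<open>R * N = n\<close> serves \<open>Gamma1\<close>, with \<open>R = 1\<close>, and
  \<open>R * N = n * n\<close> serves \<open>Gamma\<close>, with \<open>R = N = n\<close>.\<close>

lemma unit_group_pm:
  assumes "n > 0" "R > 0" "N > 0" "R * N = n \<or> R * N = n * n"
  shows "unit_group R N (pm_units n)"
proof
  have dvd: "n dvd R * N" using assms(4) by auto
  note red = cong_dvd_modulus[OF _ dvd]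
  fix x y
  show "y \<in> pm_units n" if "x \<in> pm_units n" "[x = y] (mod R * N)"
    using that red[OF that(2)] by (auto intro: cong_trans cong_sym)
  show "x * y \<in> pm_units n" if "x \<in> pm_units n" "y \<in> pm_units n"
    using that cong_mult[of x 1 n y 1] cong_mult[of x 1 n y "-1"]
      cong_mult[of x "-1" n y 1] cong_mult[of x "-1" n y "-1"] by auto
  show "y \<in> pm_units n" if "x \<in> pm_units n" "[x * y = 1] (mod R * N)"
  proof (cases "[x = 1] (mod n)")
    case True
    then have "[1 * y = 1] (mod n)"
      using cong_trans[OF cong_sym[OF cong_mult[OF True cong_refl]] red[OF that(2)]] by simp
    then show ?thesis by simp
  next
    case False
    then have "[x = -1] (mod n)" using that(1) by simp
    then have "[-1 * y = 1] (mod n)"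
      using cong_trans[OF cong_sym[OF cong_mult[OF _ cong_refl]] red[OF that(2)]] by blast
    then show ?thesis using cong_minus_minus_iff[of y "-1" n] by simp
  qed
  show "coprime x (R * N)" if "x \<in> pm_units n"
  proof -
    have "coprime x n" using that cong_imp_coprime[OF cong_sym, of x 1 n] cong_imp_coprime[OF cong_sym, of x "-1" n]
      by auto
    moreover from this have "coprime x (n * n)" by simp
    ultimately show ?thesis using assms(4) by (elim disjE) (simp_all only:)
  qed
qed (use assms in auto)

text \<open>The second branch is only reached for \<open>n > 2\<close>. For \<open>n = 2\<close> the two classes coincide, and the first
  branch has the value \<open>-1\<close> at \<open>-1\<close> precisely for \<open>e = -1\<close>.\<close>

definition pm_char :: "int \<Rightarrow> int \<Rightarrow> int \<Rightarrow> int" where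
  "pm_char n e x = (if [x = 1] (mod n) then parity_sign e ((x - 1) div n)
     else if [x = -1] (mod n) then - parity_sign e ((- x - 1) div n) else 0)"

lemma pm_char_values:
  assumes "n > 2 \<or> n = 2 \<and> e = -1"
  shows "pm_char n e (1 + n * u) = parity_sign e u" "pm_char n e (- (1 + n * u)) = - parity_sign e u"
proof -
  have "[1 + n * u = 1] (mod n)" by (simp add: cong_iff_dvd_diff)
  then show "pm_char n e (1 + n * u) = parity_sign e u"
    using assms by (auto simp: pm_char_def)
  show "pm_char n e (- (1 + n * u)) = - parity_sign e u"
  proof (cases "n = 2")
    case True
    have "[- (1 + 2 * u) = 1] (mod 2)" by (simp add: cong_iff_dvd_diff)
    \<comment> \<open>\<open>- u - 1\<close> and \<open>u\<close> have opposite parity, so for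
      \<open>e = -1\<close> the first branch produces the minus sign.\<close>
    moreover have "(- (1 + 2 * u) - 1) div 2 = - u - 1" by simp
    ultimately show ?thesis
      using True assms by (simp add: pm_char_def parity_sign_def del: minus_add_distrib)
  next
    case False
    have "\<not> [- (1 + n * u) = 1] (mod n)"
    proof
      assume "[- (1 + n * u) = 1] (mod n)"
      then have "n dvd - (1 + n * u) - 1 + n * u" unfolding cong_iff_dvd_diff by (rule dvd_add) simp
      then have "n dvd 2" by (simp add: algebra_simps)
      then show False using False assms zdvd_imp_le[of n 2] by simp
    qed
    moreover have "[- (1 + n * u) = -1] (mod n)" by (simp add: cong_iff_dvd_diff)
    moreover have "(- (- (1 + n * u)) - 1) div n = u" using assms by auto
    ultimately show ?thesis by (simp add: pm_char_def del: minus_add_distrib)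
  qed
qed

text \<open>Modulo \<open>n * n\<close> the product of \<open>1 + n * u\<close> and
  \<open>1 + n * v\<close> is \<open>1 + n * (u + v)\<close>, so an odd character is determined by
  its sign \<open>e\<close> at \<open>1 + n\<close>. Periodicity decides which \<open>e\<close>
  occur: period \<open>n\<close> forces \<open>e = 1\<close>, while period \<open>n * n\<close> only
  forces the \<open>n\<close>-th power of \<open>e\<close> to be 1. For \<open>n = 2\<close>,
  writing -1 as \<open>1 + 2 * (-1)\<close> forces \<open>e = -1\<close>; for \<open>n = 1\<close>
  no character is odd.\<close>

lemma odd_pm_chars:
  assumes n: "n > 0" and K: "R * N = n \<or> R * N = n * n" and pos: "R > 0" "N > 0"
  defines "E \<equiv> {e. (e = 1 \<or> e = -1) \<and> (n > 2 \<or> n = 2 \<and> e = -1) \<and> (e = 1 \<or> even n \<and> R * N = n * n)}"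
  shows "bij_betw (pm_char n) E {f \<in> unit_group.unit_chars R N (pm_units n). f (-1) = -1}"
proof -
  interpret unit_group R N "pm_units n" by (rule unit_group_pm[OF n pos K])
  have one_mem: "1 + n * u \<in> pm_units n" "- (1 + n * u) \<in> pm_units n" for u
    unfolding pm_units_iff by blast+
  have dvd: "R * N dvd n * n" using K by auto
  have step: "[(1 + n * u) * (1 + n * v) = 1 + n * (u + v)] (mod R * N)" for u v
    by (rule cong_dvd_modulus[OF _ dvd]) (simp add: cong_iff_dvd_diff algebra_simps)
  show ?thesis
  proof (rule bij_betw_imageI)
    show "inj_on (pm_char n) E"
    proof (rule inj_onI)
      fix e e' assume "e \<in> E" "e' \<in> E" "pm_char n e = pm_char n e'"
      then have "pm_char n e (1 + n * 1) = pm_char n e' (1 + n * 1)" by simp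
      then show "e = e'"
        using pm_char_values(1)[of n e 1] pm_char_values(1)[of n e' 1] \<open>e \<in> E\<close> \<open>e' \<in> E\<close>
        unfolding E_def parity_sign_def by auto
    qed
    show "pm_char n ` E = {f \<in> unit_chars. f (-1) = -1}"
    proof (intro equalityI subsetI)
      fix f assume "f \<in> pm_char n ` E"
      then obtain e where e: "e \<in> E" "f = pm_char n e" by blast
      then have c: "n > 2 \<or> n = 2 \<and> e = -1" by (simp add: E_def)
      note val = pm_char_values[OF c, folded e(2)]
      have sq: "e * e = 1" using e by (auto simp: E_def)
      have ev: "parity_sign e (n * k) = 1" for k
        using e(1) by (auto simp: E_def parity_sign_def)
      have prod: "f ((1 + n * u) * (1 + n * v)) = parity_sign e u * parity_sign e v"
        "f (- ((1 + n * u) * (1 + n * v))) = - (parity_sign e u * parity_sign e v)" for u v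
      proof -
        have eq: "(1 + n * u) * (1 + n * v) = 1 + n * (u + v + n * (u * v))" by (simp add: algebra_simps)
        show "f ((1 + n * u) * (1 + n * v)) = parity_sign e u * parity_sign e v"
          "f (- ((1 + n * u) * (1 + n * v))) = - (parity_sign e u * parity_sign e v)"
          unfolding eq val by (simp_all only: parity_sign_add[OF sq] ev mult_1_right)
      qed
      have "f x = 1 \<or> f x = -1" if xm: "x \<in> pm_units n" for x
      proof -
        obtain u where "x = 1 + n * u \<or> x = - (1 + n * u)" using xm unfolding pm_units_iff by blast
        moreover have "parity_sign e u = 1 \<or> parity_sign e u = -1"
          using e(1) by (auto simp: E_def parity_sign_def)
        ultimately show ?thesis using val[of u] by (elim disjE) simp_all
      qed
      moreover have "f x = 0" if "x \<notin> pm_units n" for x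
        using that by (simp add: e(2) pm_char_def)
      moreover have "f (x * y) = f x * f y" if xy: "x \<in> pm_units n" "y \<in> pm_units n" for x y
      proof -
        obtain u where u: "x = 1 + n * u \<or> x = - (1 + n * u)" using xy(1) unfolding pm_units_iff by blast
        obtain v where v: "y = 1 + n * v \<or> y = - (1 + n * v)" using xy(2) unfolding pm_units_iff by blast
        show ?thesis
          using u v by (elim disjE) (simp_all only: prod val minus_minus mult_minus_left mult_minus_right)
      qed
      moreover have "f x = f y" if xy: "x \<in> pm_units n" "[x = y] (mod R * N)" for x y
      proof -
        obtain k where k: "y = x + R * N * k" using xy(2) by (metis cong_iff_lin)
        \<comment> \<open>The period shifts \<open>u\<close> by \<open>l\<close>, which is a
          multiple of \<open>n\<close> if the modulus is \<open>n * n\<close>; otherwise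
          \<open>l\<close> is arbitrary but \<open>e = 1\<close>.\<close>
        have "\<exists>l. R * N * k = n * l \<and> parity_sign e l = 1"
        proof (cases "R * N = n * n")
          case True
          then show ?thesis using ev[of k] by (intro exI[of _ "n * k"]) simp
        next
          case False
          then show ?thesis using K e(1) by (intro exI[of _ k]) (auto simp: E_def parity_sign_def)
        qed
        then obtain l where l: "R * N * k = n * l" "parity_sign e l = 1" by blast
        then have l': "parity_sign e (- l) = 1" by (simp add: parity_sign_def)
        obtain u where "x = 1 + n * u \<or> x = - (1 + n * u)" using xy(1) unfolding pm_units_iff by blast
        then show ?thesis
        proof
          assume x: "x = 1 + n * u"
          have y: "y = 1 + n * (u + l)" unfolding k l(1) x by (simp add: algebra_simps)
          show ?thesis unfolding y unfolding x val by (simp only: parity_sign_add[OF sq] l mult_1_right)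
        next
          assume x: "x = - (1 + n * u)"
          have y: "y = - (1 + n * (u + - l))" unfolding k l(1) x by (simp add: algebra_simps)
          show ?thesis unfolding y unfolding x val by (simp only: parity_sign_add[OF sq] l' mult_1_right)
        qed
      qed
      moreover have "f (-1) = -1" using val(2)[of 0] by (simp add: parity_sign_def)
      ultimately show "f \<in> {f \<in> unit_chars. f (-1) = -1}"
        unfolding unit_chars_def mem_Collect_eq by blast
    next
      fix f assume "f \<in> {f \<in> unit_chars. f (-1) = -1}"
      then have f: "f \<in> unit_chars" "f (-1) = -1" by auto
      note D = unit_charsD[OF f(1)]
      define e where "e = f (1 + n)"
      have "f (1 + n * (u + v)) = f (1 + n * u) * f (1 + n * v)" for u v
        using D(3)[OF one_mem(1)[of u] one_mem(1)[of v]]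
          D(4)[OF U_mult[OF one_mem(1)[of u] one_mem(1)[of v]] step] by simp
      then have h: "f (1 + n * u) = parity_sign e u" for u
        unfolding e_def parity_sign_def using D(1)[OF one_mem(1)]
        by (subst sign_hom_eq[of "\<lambda>u. f (1 + n * u)"]) simp_all
      have "-1 \<in> pm_units n" by simp
      then have h': "f (- (1 + n * u)) = - parity_sign e u" for u
        using D(3)[OF _ one_mem(1)[of u], of "-1"] h[of u] f(2) by simp
      have ee: "e = 1 \<or> e = -1" unfolding e_def using D(1)[OF one_mem(1), of 1] by simp
      have "n \<noteq> 1"
      proof
        assume "n = 1"
        \<comment> \<open>Here -1 is \<open>1 + 1 * (-2)\<close>, and the even exponent gives the
          value 1.\<close>
        then show False using h[of 0] h[of "-1"] h[of "-2"] f(2) by (simp add: parity_sign_def split: if_splits)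
      qed
      moreover have "e = -1" if "n = 2"
        using h[of "-1"] f(2) that by (simp add: parity_sign_def)
      ultimately have c: "n > 2 \<or> n = 2 \<and> e = -1" using n by linarith
      have "e = 1 \<or> even n \<and> R * N = n * n"
      proof (cases "R * N = n * n")
        case True
        have "[1 = 1 + n * n] (mod R * N)" using True by (simp add: cong_iff_dvd_diff)
        then have "parity_sign e n = 1" using D(4)[OF _ , of 1 "1 + n * n"] D(5) h[of n] by simp
        then show ?thesis using True by (auto simp: parity_sign_def split: if_splits)
      next
        case False
        then have "[1 = 1 + n] (mod R * N)" using K by (simp add: cong_iff_dvd_diff)
        then show ?thesis using D(4)[OF _ , of 1 "1 + n"] D(5) by (simp add: e_def)
      qed
      then have "e \<in> E" using ee c by (simp add: E_def)
      moreover have "f x = pm_char n e x" for x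
      proof (cases "x \<in> pm_units n")
        case True
        then show ?thesis unfolding pm_units_iff using h h' pm_char_values[OF c] by auto
      next
        case False
        then show ?thesis using D(2)[OF False] by (simp add: pm_char_def)
      qed
      then have "f = pm_char n e" by (rule ext)
      ultimately show "f \<in> pm_char n ` E" by blast
    qed
  qed
qed

text \<open>\<open>H\<close> may lack \<open>- mat 1\<close>, but \<open>G\<close> is
  \<open>H\<close> together with its negative and has the same image, and lifts depend on the image
  alone.\<close>

lemma card_lifts_pm:
  assumes "n > 0" and K: "R * N = n \<or> R * N = n * n" and "R > 0" "N > 0"
    and H: "\<And>A. A \<in> H \<longleftrightarrow> det A = 1 \<and> R dvd A $ 1 $ 2 \<and> N dvd A $ 2 $ 1 \<and> [A $ 1 $ 1 = 1] (mod n)"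
  shows "card (congruence_lifts (to_PSL2Z ` H))
    = 1 + card {e :: int. (e = 1 \<or> e = -1) \<and> (n > 2 \<or> n = 2 \<and> e = -1) \<and> (e = 1 \<or> even n \<and> R * N = n * n)}
        * (if odd n then 2 else 4)"
proof -
  interpret unit_group R N "pm_units n" by (rule unit_group_pm) fact+
  let ?E = "{e :: int. (e = 1 \<or> e = -1) \<and> (n > 2 \<or> n = 2 \<and> e = -1) \<and> (e = 1 \<or> even n \<and> R * N = n * n)}"
  have b: "bij_betw (pm_char n) ?E {f \<in> unit_chars. f (-1) = -1}"
    by (rule odd_pm_chars) fact+
  have "finite ?E" by (rule finite_subset[of _ "{1, -1}"]) auto
  then have "finite {f \<in> unit_chars. f (-1) = -1}" using bij_betw_finite[OF b] by simp
  moreover have "A \<in> H \<or> - A \<in> H \<longleftrightarrow> A \<in> G \<or> - A \<in> G" for A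
  proof -
    have "[- (A $ 1 $ 1) = 1] (mod n) \<longleftrightarrow> [A $ 1 $ 1 = -1] (mod n)"
      using cong_minus_minus_iff[of "A $ 1 $ 1" "-1" n] by simp
    moreover have "[- (A $ 1 $ 1) = -1] (mod n) \<longleftrightarrow> [A $ 1 $ 1 = 1] (mod n)"
      by (rule cong_minus_minus_iff)
    ultimately show ?thesis
      unfolding H mem_G mem_Collect_eq matrix_neg_simps(3) by auto
  qed
  then have "to_PSL2Z ` H = to_PSL2Z ` G"
    unfolding to_PSL2Z_image_eq_iff by blast
  moreover have "odd (R * N) \<longleftrightarrow> odd n" using K by (metis even_mult_iff)
  ultimately show ?thesis
    using card_lifts_G bij_betw_same_card[OF b] by simp
qed

lemma cong_inverse_one:
  fixes a d :: int
  assumes "[a = 1] (mod n)" "[a * d = 1] (mod n)" shows "[d = 1] (mod n)"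
  using cong_mult[OF assms(1) cong_refl[of d]] assms(2) by (simp add: cong_def)

lemma card_lifts_Gamma1:
  assumes "N \<ge> 1"
  shows "card (congruence_lifts (to_PSL2Z ` Gamma1 N)) = (if N \<le> 2 then 1 else if odd N then 3 else 5)"
proof -
  have mem: "A \<in> Gamma1 N \<longleftrightarrow> det A = 1 \<and> 1 dvd A $ 1 $ 2 \<and> int N dvd A $ 2 $ 1 \<and> [A $ 1 $ 1 = 1] (mod int N)" for A
  proof -
    have "[A $ 2 $ 2 = 1] (mod int N)"
      if "det A = 1" "int N dvd A $ 2 $ 1" "[A $ 1 $ 1 = 1] (mod int N)"
    proof (rule cong_inverse_one[OF that(3)])
      have "A $ 1 $ 1 * A $ 2 $ 2 - 1 = A $ 1 $ 2 * A $ 2 $ 1" using that(1) by (simp add: det_eq)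
      then show "[A $ 1 $ 1 * A $ 2 $ 2 = 1] (mod int N)"
        using that(2) by (simp add: cong_iff_dvd_diff)
    qed
    then show ?thesis by (auto simp: Gamma1_def cong_0_iff)
  qed
  have "card (congruence_lifts (to_PSL2Z ` Gamma1 N))
    = 1 + card {e :: int. (e = 1 \<or> e = -1) \<and> (int N > 2 \<or> int N = 2 \<and> e = -1)
        \<and> (e = 1 \<or> even (int N) \<and> 1 * int N = int N * int N)} * (if odd (int N) then 2 else 4)"
    by (rule card_lifts_pm) (use assms mem in auto)
  \<comment> \<open>For \<open>N \<ge> 2\<close> the modulus \<open>N\<close> differs from
    \<open>N * N\<close>, which leaves \<open>e = 1\<close>; at \<open>N = 2\<close> this
    contradicts \<open>e = -1\<close>.\<close>
  moreover have "{e :: int. (e = 1 \<or> e = -1) \<and> (int N > 2 \<or> int N = 2 \<and> e = -1)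
        \<and> (e = 1 \<or> even (int N) \<and> 1 * int N = int N * int N)} = (if N \<le> 2 then {} else {1})"
    using assms by auto
  ultimately show ?thesis by simp
qed

lemma card_lifts_Gamma:
  assumes "N \<ge> 1"
  shows "card (congruence_lifts (to_PSL2Z ` Gamma N))
    = (if N = 1 then 1 else if odd N then 3 else if N = 2 then 5 else 9)"
proof -
  have mem: "A \<in> Gamma N \<longleftrightarrow> det A = 1 \<and> int N dvd A $ 1 $ 2 \<and> int N dvd A $ 2 $ 1 \<and> [A $ 1 $ 1 = 1] (mod int N)" for A
  proof -
    have "[A $ 2 $ 2 = 1] (mod int N)"
      if "det A = 1" "int N dvd A $ 2 $ 1" "[A $ 1 $ 1 = 1] (mod int N)"
    proof (rule cong_inverse_one[OF that(3)])
      have "A $ 1 $ 1 * A $ 2 $ 2 - 1 = A $ 1 $ 2 * A $ 2 $ 1" using that(1) by (simp add: det_eq)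
      then show "[A $ 1 $ 1 * A $ 2 $ 2 = 1] (mod int N)"
        using that(2) by (simp add: cong_iff_dvd_diff)
    qed
    then show ?thesis by (auto simp: mem_Gamma cong_0_iff)
  qed
  have "card (congruence_lifts (to_PSL2Z ` Gamma N))
    = 1 + card {e :: int. (e = 1 \<or> e = -1) \<and> (int N > 2 \<or> int N = 2 \<and> e = -1)
        \<and> (e = 1 \<or> even (int N) \<and> int N * int N = int N * int N)} * (if odd (int N) then 2 else 4)"
    by (rule card_lifts_pm) (use assms mem in auto)
  \<comment> \<open>Even \<open>N > 2\<close> has two odd characters with four sign pairs each,
    giving 9; for \<open>N = 2\<close> only \<open>e = -1\<close> survives, giving 5.\<close>
  moreover have "{e :: int. (e = 1 \<or> e = -1) \<and> (int N > 2 \<or> int N = 2 \<and> e = -1)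
        \<and> (e = 1 \<or> even (int N) \<and> int N * int N = int N * int N)}
    = (if N = 1 then {} else if odd N then {1} else if N = 2 then {-1} else {1, -1})"
    using assms by auto
  ultimately show ?thesis by auto
qed

theorem theorem1:
  fixes N s t :: nat and p e :: "nat \<Rightarrow> nat"
  assumes "N \<ge> 1"
    and "N = 2 ^ s * (\<Prod>i<t. p i ^ e i)"
    and "\<forall>i<t. prime (p i) \<and> odd (p i)"
    and "inj_on p {..<t}"
    and "\<forall>i<t. e i \<ge> 1"
  shows
    "((s \<le> 1 \<and> (\<forall>i<t. [p i = 1] (mod 4)) \<longrightarrow>
          card (congruence_lifts (to_PSL2Z ` Gamma0 N)) = 1)
      \<and> (s \<le> 1 \<and> (\<exists>i<t. [p i = 3] (mod 4)) \<longrightarrow>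
          card (congruence_lifts (to_PSL2Z ` Gamma0 N)) = 1 + 2 ^ (s + t))
      \<and> (s \<ge> 2 \<longrightarrow>
          card (congruence_lifts (to_PSL2Z ` Gamma0 N)) = 1 + 2 ^ (min 3 s + t)))
    \<and> ((N \<le> 2 \<longrightarrow> card (congruence_lifts (to_PSL2Z ` Gamma1 N)) = 1)
      \<and> (N > 2 \<and> odd N \<longrightarrow> card (congruence_lifts (to_PSL2Z ` Gamma1 N)) = 3)
      \<and> (N > 2 \<and> even N \<longrightarrow> card (congruence_lifts (to_PSL2Z ` Gamma1 N)) = 5))
    \<and> ((N = 1 \<longrightarrow> card (congruence_lifts (to_PSL2Z ` Gamma N)) = 1)
      \<and> (N > 1 \<and> odd N \<longrightarrow> card (congruence_lifts (to_PSL2Z ` Gamma N)) = 3)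
      \<and> (N = 2 \<longrightarrow> card (congruence_lifts (to_PSL2Z ` Gamma N)) = 5)
      \<and> (N > 2 \<and> even N \<longrightarrow> card (congruence_lifts (to_PSL2Z ` Gamma N)) = 9))"
proof -
  let ?L = "card (congruence_lifts (to_PSL2Z ` Gamma0 N))"
  let ?O = "{f \<in> real_chars (int N). f (-1) = -1}"
  have N: "int N = 2 ^ s * (\<Prod>i<t. int (p i) ^ e i)" by (simp add: assms(2))
  note Q = real_chars_factorization[OF assms(3-5), of s, folded N]
  have fin: "finite (real_chars (int N))" by (rule card_ge_0_finite) (simp add: Q(1))
  have "odd (\<Prod>i<t. p i ^ e i)" using assms(3) by (simp add: even_prod_iff)
  then have parity: "odd N \<longleftrightarrow> s = 0" unfolding assms(2) by simp
  have L: "?L = 1 + card ?O * (if s = 0 then 2 else 4)"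
    unfolding card_lifts_Gamma0[OF assms(1) fin] parity by (rule refl)
  have O: "2 * card ?O = 2 ^ (t + (if s \<le> 1 then 0 else min 3 s - 1))"
    if odd_prime: "s \<ge> 2 \<or> (\<exists>i<t. [p i = 3] (mod 4))"
  proof -
    obtain g where "g \<in> real_chars (int N)" "g (-1) = -1" using Q(3)[OF odd_prime] by blast
    then show ?thesis using card_odd_real_chars[OF _ _ fin] Q(1) by simp
  qed
  have "?L = 1" if "s \<le> 1" "\<forall>i<t. [p i = 1] (mod 4)"
  proof -
    have "?O = {}" using Q(2)[OF that] by fastforce
    then have "card ?O = 0" by (simp only: card.empty)
    then show ?thesis unfolding L by simp
  qed
  moreover have "?L = 1 + 2 ^ (s + t)" if "s \<le> 1" "\<exists>i<t. [p i = 3] (mod 4)"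
  proof -
    have "2 * card ?O = 2 ^ t" using O that by simp
    \<comment> \<open>The number of sign pairs, 2 or 4, is \<open>2 * 2 ^ s\<close>; its first
      factor doubles \<open>card ?O\<close>.\<close>
    moreover have "s = 0 \<or> s = 1" using that(1) by linarith
    ultimately show ?thesis unfolding L by auto
  qed
  moreover have "?L = 1 + 2 ^ (min 3 s + t)" if "s \<ge> 2"
  proof -
    \<comment> \<open>With four sign pairs the count is
      \<open>4 * card ?O = 2 * 2 ^ (t + r)\<close>, and \<open>Suc r = min 3 s\<close>.\<close>
    define r where "r = min 3 s - 1"
    have "min 3 s = Suc r" "2 * card ?O = 2 ^ (t + r)" using O that by (auto simp: r_def)
    then show ?thesis unfolding L using that by (simp add: power_add)
  qed
  ultimately show ?thesis
    using card_lifts_Gamma1[OF assms(1)] card_lifts_Gamma[OF assms(1)] by auto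
qed

end
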